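(* Let $\alpha>0$, let $n\ge 2$ be an integer, and let $f\in Q_n([0,\alpha))$. Suppose that the function $t\mapsto \frac{f(t)-f(0)}{t}$ is $(n-1)$-monotone on $(0,\alpha)$. Then $f$ is $(n-1)$-convex on $[0,\alpha)$. In particular, if $f(0)=0$, then $(n-1)$-monotonicity of $\frac{f(t)}{t}$ on $(0,\alpha)$ implies $(n-1)$-convexity of $f$ on $[0,\alpha)$.
   Context: Let $M_n$ be the algebra of $n\times n$ complex matrices and $I\subset\mathbb{R}$ an interval. A function $f:I\to\mathbb{R}$ is $n$-monotone on $I$ if $A\le B$ implies $f(A)\le f(B)$ for all selfadjoint $A,B\in M_n$ whose eigenvalues all lie in $I$ (functional calculus). It is $n$-convex on $I$ if $f(\lambda A+(1-\lambda)B)\le \lambda f(A)+(1-\lambda)f(B)$ for all $\lambda\in[0,1]$ and all selfadjoint $A,B\in M_n$ whose eigenvalues all lie in $I$. For a $C^1$ function $f$ on $I$, the first divided difference is $[s,t]_f=\frac{f(s)-f(t)}{s-t}$ for $s\ne t$ and $[s,s]_f=f'(s)$ (one-sided derivative at an endpoint belonging to $I$). A Hermitian $n\times n$ matrix $A$ is almost positive (conditionally positive definite) if $\sum_{i,j}A_{ij}x_j\overline{x_i}\ge 0$ for all $x\in\mathbb{C}^n$ with $\sum_{i=1}^n x_i=0$. For $n\ge2$, $Q_n(I)$ is the class of all real $C^1$ functions $f$ on $I$ such that for all $\lambda_1,\dots,\lambda_n\in I$ the Loewner matrix $([\lambda_i,\lambda_j]_f)_{1\le i,j\le n}$ is almost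 positive. *)

theory Defs
  imports
    "HOL-Analysis.Derivative"
    "Jordan_Normal_Form.Spectral_Radius"
    "Jordan_Normal_Form.Schur_Decomposition"
begin

unbundle no vec_syntax

definition hermitian :: "complex mat \<Rightarrow> bool" where
  "hermitian A \<longleftrightarrow> A \<in> carrier_mat (dim_row A) (dim_row A) \<and> mat_adjoint A = A"

definition unitary :: "complex mat \<Rightarrow> bool" where
  "unitary U \<longleftrightarrow> U \<in> carrier_mat (dim_row U) (dim_row U) \<and>
     mat_adjoint U * U = 1\<^sub>m (dim_row U) \<and> U * mat_adjoint U = 1\<^sub>m (dim_row U)"

text \<open>In the order on the complex numbers from \<^theory>\<open>HOL-Library.Complex_Order\<close>,
  \<open>0 \<le> z\<close> means that \<open>z\<close> is real and nonnegative.\<close>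

definition pos_semidef :: "complex mat \<Rightarrow> bool" where
  "pos_semidef A \<longleftrightarrow> hermitian A \<and>
     (\<forall>x \<in> carrier_vec (dim_row A). 0 \<le> (A *\<^sub>v x) \<bullet>c x)"

definition loewner_le :: "complex mat \<Rightarrow> complex mat \<Rightarrow> bool" where
  "loewner_le A B \<longleftrightarrow> pos_semidef (B - A)"

text \<open>The selfadjoint elements of the \<open>n \<times> n\<close> matrices with all eigenvalues in \<open>I\<close>.\<close>

definition selfadjoint_in :: "nat \<Rightarrow> real set \<Rightarrow> complex mat set" where
  "selfadjoint_in n I =
     {A \<in> carrier_mat n n. hermitian A \<and> spectrum A \<subseteq> complex_of_real ` I}"

definition diagonalizes :: "complex mat \<Rightarrow> (nat \<Rightarrow> real) \<Rightarrow> complex mat \<Rightarrow> bool" where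
  "diagonalizes U d A \<longleftrightarrow> unitary U \<and>
     A = U * mat_diag (dim_row U) (\<lambda>i. complex_of_real (d i)) * mat_adjoint U"

text \<open>Functional calculus. Every hermitian matrix has a unitary diagonalization, and the
  result does not depend on which one is taken, see \<open>matfun_eq\<close> below. Only the values of
  \<open>f\<close> on the spectrum of \<open>A\<close> matter.\<close>

definition matfun :: "(real \<Rightarrow> real) \<Rightarrow> complex mat \<Rightarrow> complex mat" where
  "matfun f A = (THE B. \<exists>U d. diagonalizes U d A \<and> diagonalizes U (\<lambda>i. f (d i)) B)"

definition matrix_monotone :: "nat \<Rightarrow> real set \<Rightarrow> (real \<Rightarrow> real) \<Rightarrow> bool" where
  "matrix_monotone n I f \<longleftrightarrow>
     (\<forall>A \<in> selfadjoint_in n I. \<forall>B \<in> selfadjoint_in n I.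
        loewner_le A B \<longrightarrow> loewner_le (matfun f A) (matfun f B))"

definition matrix_convex :: "nat \<Rightarrow> real set \<Rightarrow> (real \<Rightarrow> real) \<Rightarrow> bool" where
  "matrix_convex n I f \<longleftrightarrow>
     (\<forall>l \<in> {0..1::real}. \<forall>A \<in> selfadjoint_in n I. \<forall>B \<in> selfadjoint_in n I.
        loewner_le
          (matfun f (complex_of_real l \<cdot>\<^sub>m A + complex_of_real (1 - l) \<cdot>\<^sub>m B))
          (complex_of_real l \<cdot>\<^sub>m matfun f A + complex_of_real (1 - l) \<cdot>\<^sub>m matfun f B))"

text \<open>Derivatives are taken within \<open>I\<close>, hence are one-sided at an endpoint of an interval
  \<open>I\<close> that belongs to \<open>I\<close>. (The library's \<open>C1_differentiable_on\<close> would
  demand two-sided differentiability there.)\<close>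

definition C1_within :: "real set \<Rightarrow> (real \<Rightarrow> real) \<Rightarrow> bool" where
  "C1_within I f \<longleftrightarrow> (\<forall>t \<in> I. f differentiable (at t within I)) \<and>
     continuous_on I (\<lambda>t. vector_derivative f (at t within I))"

definition div_diff :: "real set \<Rightarrow> (real \<Rightarrow> real) \<Rightarrow> real \<Rightarrow> real \<Rightarrow> real" where
  "div_diff I f s t =
     (if s = t then vector_derivative f (at s within I) else (f s - f t) / (s - t))"

definition almost_positive :: "complex mat \<Rightarrow> bool" where
  "almost_positive A \<longleftrightarrow> hermitian A \<and>
     (\<forall>x \<in> carrier_vec (dim_row A). (\<Sum>i<dim_row A. x $ i) = 0 \<longrightarrow>
        0 \<le> (\<Sum>i<dim_row A. \<Sum>j<dim_row A. A $$ (i, j) * x $ j * cnj (x $ i)))"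

definition loewner_matrix ::
  "nat \<Rightarrow> real set \<Rightarrow> (real \<Rightarrow> real) \<Rightarrow> (nat \<Rightarrow> real) \<Rightarrow> complex mat" where
  "loewner_matrix n I f l =
     mat n n (\<lambda>(i, j). complex_of_real (div_diff I f (l i) (l j)))"

definition Q_class :: "nat \<Rightarrow> real set \<Rightarrow> (real \<Rightarrow> real) set" where
  "Q_class n I = {f. C1_within I f \<and>
     (\<forall>l. (\<forall>i<n. l i \<in> I) \<longrightarrow> almost_positive (loewner_matrix n I f l))}"

lemma mat_adjoint_carrier: "U \<in> carrier_mat n m \<Longrightarrow> mat_adjoint U \<in> carrier_mat m n"
  by (auto simp: mat_adjoint_def)

text \<open>The functional calculus may be computed with any unitary diagonalization.\<close>

lemma diagonalizes_unique:
  assumes "diagonalizes U d A" "diagonalizes V e A"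
    and "diagonalizes U (\<lambda>i. f (d i)) B" "diagonalizes V (\<lambda>i. f (e i)) C"
  shows "B = C"
proof -
  define n where "n = dim_row A"
  let ?D = "\<lambda>d. mat_diag n (\<lambda>i. complex_of_real (d i))"
  have dims: "dim_row U = n" "dim_row V = n"
    using assms(1,2) unfolding diagonalizes_def n_def by (metis index_mult_mat(2))+
  have U: "U \<in> carrier_mat n n" "mat_adjoint U * U = 1\<^sub>m n" "U * mat_adjoint U = 1\<^sub>m n"
    and V: "V \<in> carrier_mat n n" "mat_adjoint V * V = 1\<^sub>m n" "V * mat_adjoint V = 1\<^sub>m n"
    using assms dims unfolding diagonalizes_def unitary_def by auto
  note c = U(1) V(1) mat_adjoint_carrier[OF U(1)] mat_adjoint_carrier[OF V(1)]
  have conj: "mat_adjoint V * (X * E * mat_adjoint X) * U = mat_adjoint V * X * E * (mat_adjoint X * U)"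
    if "X \<in> carrier_mat n n" "E \<in> carrier_mat n n" for X E
    using c that mat_adjoint_carrier[OF that(1)] by (simp add: assoc_mult_mat[of _ n n _ n _ n])
  define W where "W = mat_adjoint V * U"
  have W: "W \<in> carrier_mat n n" using c unfolding W_def by auto
  have A: "U * ?D d * mat_adjoint U = V * ?D e * mat_adjoint V"
    using assms dims unfolding diagonalizes_def by auto
  have "W * ?D d = ?D e * W"
    using arg_cong[OF A, of "\<lambda>M. mat_adjoint V * M * U"] U V W
    by (simp add: conj W_def[symmetric] left_mult_one_mat[of _ n n]
        right_mult_one_mat[of _ n n] mult_carrier_mat[of _ n n _ n])
  then have ij: "W $$ (i, j) * d j = e i * W $$ (i, j)" if "i < n" "j < n" for i j
    using that W by (simp add: mat_diag_mult_left[OF W] mat_diag_mult_right[OF W] mat_eq_iff)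
  have "W $$ (i, j) * f (d j) = f (e i) * W $$ (i, j)" if "i < n" "j < n" for i j
    using ij[OF that] by (cases "W $$ (i, j) = 0") (auto simp: mult.commute)
  then have WD: "W * ?D (\<lambda>i. f (d i)) = ?D (\<lambda>i. f (e i)) * W"
    using W by (simp add: mat_diag_mult_left[OF W] mat_diag_mult_right[OF W] mat_eq_iff)
  have VW: "V * W = U"
    using c U V unfolding W_def by (simp add: assoc_mult_mat[of _ n n _ n _ n, symmetric])
  have WU: "W * mat_adjoint U = mat_adjoint V"
    using c U V unfolding W_def by (simp add: assoc_mult_mat[of _ n n _ n _ n])
  have "B = V * W * ?D (\<lambda>i. f (d i)) * mat_adjoint U"
    using assms(3) dims VW unfolding diagonalizes_def by auto
  also have "\<dots> = V * (W * ?D (\<lambda>i. f (d i))) * mat_adjoint U"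
    using c W by (simp add: assoc_mult_mat[of _ n n _ n _ n])
  also have "\<dots> = V * ?D (\<lambda>i. f (e i)) * (W * mat_adjoint U)"
    unfolding WD using c W
    by (simp add: assoc_mult_mat[of _ n n _ n _ n] mult_carrier_mat[of _ n n _ n])
  also have "\<dots> = C"
    unfolding WU using assms(4) dims unfolding diagonalizes_def by auto
  finally show ?thesis .
qed

lemma matfun_eq:
  assumes "diagonalizes U d A"
  shows "matfun f A = U * mat_diag (dim_row U) (\<lambda>i. complex_of_real (f (d i))) * mat_adjoint U"
  unfolding matfun_def
proof (rule the_equality)
  show "\<exists>V e. diagonalizes V e A \<and> diagonalizes V (\<lambda>i. f (e i))
      (U * mat_diag (dim_row U) (\<lambda>i. complex_of_real (f (d i))) * mat_adjoint U)"
    using assms by (intro exI[of _ U] exI[of _ d]) (auto simp: diagonalizes_def)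
next
  fix B assume "\<exists>V e. diagonalizes V e A \<and> diagonalizes V (\<lambda>i. f (e i)) B"
  then obtain V e where "diagonalizes V e A" "diagonalizes V (\<lambda>i. f (e i)) B" by blast
  then show "B = U * mat_diag (dim_row U) (\<lambda>i. complex_of_real (f (d i))) * mat_adjoint U"
    using assms by (intro diagonalizes_unique[of V e A U d f]) (auto simp: diagonalizes_def)
qed

end

theory Submission
  imports Defs
begin

text \<open>
  Write \<open>N = n - 1\<close> and let \<open>[\<dots>]\<close> denote divided differences of \<open>f\<close>. The proof rests on the
  positivity of the \<open>N \<times> N\<close> matrices \<open>[s, c\<^sub>k, c\<^sub>l]\<close> for all \<open>s\<close> and all nodes \<open>c\<^sub>k\<close> in \<open>[0, \<alpha>)\<close>. To
  include the case that \<open>s\<close> is a node, it is stated for the matrices of Newton remainders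
  \<open>(s - c\<^sub>k) (s - c\<^sub>l) [s, c\<^sub>k, c\<^sub>l]\<close>, which make sense for every \<open>C\<^sup>1\<close> function (\<open>nrem_nonneg\<close>).

  Such positivity suffices for convexity. If \<open>C\<close> has eigenvalues \<open>c\<^sub>k\<close> and \<open>A\<close> has
  eigenvalues \<open>a\<^sub>i\<close>, then \<open>f(A) - f(C)\<close> minus the derivative of the functional calculus at \<open>C\<close> in the
  direction \<open>A - C\<close> is, in the eigenbasis of \<open>C\<close>, a sum over \<open>i\<close> of Schur products of the matrices
  of Newton remainders \<open>(a\<^sub>i - c\<^sub>k) (a\<^sub>i - c\<^sub>l) [a\<^sub>i, c\<^sub>k, c\<^sub>l]\<close> with positive matrices of rank
  one (\<open>matfun_newton_remainder\<close>). This is an exact identity that needs no second derivative. With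
  \<open>C\<close> a convex combination of \<open>A\<close> and \<open>B\<close>, the derivative terms cancel (\<open>matrix_convexI\<close>).

  To obtain the positivity, let \<open>s\<close> move. The derivative of \<open>[s, c\<^sub>k, c\<^sub>l]\<close> in \<open>s\<close> is \<open>[s, s, c\<^sub>k, c\<^sub>l]\<close>,
  and the matrix of these numbers is positive because the Loewner matrix at the \<open>n\<close> points
  \<open>c\<^sub>1, \<dots>, c\<^sub>N, s\<close> is almost positive. So \<open>[s, c\<^sub>k, c\<^sub>l]\<close> increases in the matrix order while \<open>s\<close> avoids
  the nodes. When \<open>s\<close> crosses a node it may jump, as \<open>f\<close> is only \<open>C\<^sup>1\<close>, but the jump is positive since
  \<open>f'\<close> is convex, which is the content of almost positivity at two points (\<open>phi_jump\<close>, \<open>phi_le\<close>).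
  At \<open>s = 0\<close> the matrix \<open>[0, c\<^sub>k, c\<^sub>l]\<close> is the Loewner matrix of \<open>t \<mapsto> (f t - f 0) / t\<close>, which is positive
  by matrix monotonicity (\<open>matrix_monotone_imp_loewner_nonneg\<close>).
\<close>

section \<open>Divided differences of a continuously differentiable function\<close>

lemma difference_quotient_continuous_on:
  fixes g :: "real \<Rightarrow> real"
  assumes "continuous_on S g" and "(g has_real_derivative g') (at c within S)"
  shows "continuous_on S (\<lambda>u. if u = c then g' else (g u - g c) / (u - c))" (is "continuous_on S ?q")
  unfolding continuous_on_def
proof
  fix u assume u: "u \<in> S"
  show "(?q \<longlongrightarrow> ?q u) (at u within S)"
  proof (cases "u = c")
    case True
    have "\<forall>\<^sub>F y in at c within S. (g y - g c) / (y - c) = ?q y"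
      by (auto simp: eventually_at_filter)
    from Lim_transform_eventually[OF _ this] show ?thesis
      using assms(2) by (simp add: True has_field_derivative_iff)
  next
    case False
    have "((\<lambda>y. (g y - g c) / (y - c)) \<longlongrightarrow> (g u - g c) / (u - c)) (at u within S)"
      using False assms(1) u by (intro tendsto_intros) (auto simp: continuous_on_def)
    moreover have "\<forall>\<^sub>F y in at u within S. y \<noteq> c"
      by (rule tendsto_imp_eventually_ne[OF tendsto_ident_at False])
    then have "\<forall>\<^sub>F y in at u within S. (g y - g c) / (y - c) = ?q y"
      by eventually_elim simp
    ultimately show ?thesis
      using False by (simp add: Lim_transform_eventually)
  qed
qed

text \<open>A continuously differentiable function on the half-open interval \<open>[0, \<alpha>)\<close>. Inside this
  context \<open>D\<close> denotes its first divided difference \<open>[s, t]\<close>.\<close>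

locale C1_fun =
  fixes \<alpha> :: real and f :: "real \<Rightarrow> real"
  assumes C1: "C1_within {0..<\<alpha>} f"
begin

abbreviation "I \<equiv> {0..<\<alpha>}"
abbreviation "D \<equiv> div_diff I f"

text \<open>The derivative, which is one-sided at \<open>0\<close>.\<close>

definition "f' t = vector_derivative f (at t within I)"

text \<open>The remainder at \<open>u\<close> of the Newton interpolation of \<open>f\<close> in the nodes \<open>c\<close>, \<open>d\<close>. It is defined
  and continuous without a second derivative, even where nodes coincide with \<open>u\<close>.\<close>

definition "nrem u c d = f u - f c - D c d * (u - c)"

text \<open>The divided difference \<open>[u, c, d]\<close>. The nodes \<open>c\<close>, \<open>d\<close> may coincide, but the value is meaningful
  only for \<open>u \<noteq> c\<close> and \<open>u \<noteq> d\<close>; otherwise it is \<open>0\<close> by the division convention.\<close>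

definition "D3 u c d = nrem u c d / ((u - c) * (u - d))"

lemma has_deriv: "t \<in> I \<Longrightarrow> (f has_real_derivative f' t) (at t within I)"
  using C1 unfolding C1_within_def f'_def has_real_derivative_iff_has_vector_derivative
  by (simp add: vector_derivative_works)

lemma has_deriv_interior:
  assumes "0 < t" "t < \<alpha>" shows "(f has_real_derivative f' t) (at t)"
proof -
  have "(f has_real_derivative f' t) (at t within {0<..<\<alpha>})"
    by (rule DERIV_subset[OF has_deriv]) (use assms in auto)
  then show ?thesis using assms by (subst (asm) at_within_open) auto
qed

lemma f'_cont: "continuous_on I f'"
  using C1 unfolding C1_within_def f'_def by simp

lemma f_cont: "continuous_on I f"
  using has_deriv DERIV_continuous_on by blast

lemma D_same: "D c c = f' c"
  by (simp add: div_diff_def f'_def)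

lemma D_sym: "D c d = D d c"
  unfolding div_diff_def using minus_divide_divide[of "f c - f d" "c - d"] by simp

lemma D_mult: "D c d * (c - d) = f c - f d"
  by (simp add: div_diff_def)

lemma D_cont:
  assumes c: "c \<in> I" shows "continuous_on I (\<lambda>u. D u c)"
  using difference_quotient_continuous_on[OF f_cont has_deriv[OF c]]
  by (simp add: div_diff_def f'_def cong: if_cong)

lemma nrem_factor: "nrem u c d = (u - c) * (D u c - D c d)"
  using D_mult[of u c] by (simp add: nrem_def algebra_simps)

lemma nrem_sym: "nrem u c d = nrem u d c"
  using D_mult[of c d] D_sym[of c d] by (simp add: nrem_def algebra_simps)

lemma D3_sym: "D3 u c d = D3 u d c"
  unfolding D3_def by (subst nrem_sym) (simp add: mult.commute)

lemma nrem_eq_D3: "u \<noteq> c \<Longrightarrow> u \<noteq> d \<Longrightarrow> nrem u c d = (u - c) * (u - d) * D3 u c d"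
  by (simp add: D3_def)

lemma D3_eq: "u \<noteq> c \<Longrightarrow> D3 u c d = (D u c - D c d) / (u - d)"
  by (simp add: D3_def nrem_factor)

text \<open>The derivative is \<open>[u, u, c, d]\<close>, written out in first divided differences.\<close>

lemma D3_has_derivative:
  assumes "0 < u" "u < \<alpha>" "u \<noteq> c" "u \<noteq> d"
  shows "((\<lambda>u. D3 u c d) has_real_derivative
           (f' u - D u c - D u d + D c d) / ((u - c) * (u - d))) (at u)"
proof -
  have 1: "nrem u c d / (u - c) = D u c - D c d"
    using assms by (simp add: nrem_factor)
  have "nrem u c d = (u - d) * (D u d - D c d)"
    using nrem_factor[of u d c] unfolding nrem_sym[of u d c] D_sym[of d c] .
  then have 2: "nrem u c d / (u - d) = D u d - D c d"
    using assms by simp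
  have dK: "((\<lambda>u. nrem u c d) has_real_derivative f' u - D c d) (at u)"
    unfolding nrem_def using has_deriv_interior[OF assms(1,2)]
    by (auto intro!: derivative_eq_intros)
  have dP: "((\<lambda>u. (u - c) * (u - d)) has_real_derivative (u - d) + (u - c)) (at u)"
    by (auto intro!: derivative_eq_intros)
  have "((\<lambda>u. D3 u c d) has_real_derivative
      ((f' u - D c d) * ((u - c) * (u - d)) - nrem u c d * ((u - d) + (u - c)))
        / (((u - c) * (u - d)) * ((u - c) * (u - d)))) (at u)"
    unfolding D3_def by (rule DERIV_divide[OF dK dP]) (use assms in simp)
  also have "((f' u - D c d) * ((u - c) * (u - d)) - nrem u c d * ((u - d) + (u - c)))
        / (((u - c) * (u - d)) * ((u - c) * (u - d)))
      = (f' u - D c d - nrem u c d / (u - c) - nrem u c d / (u - d)) / ((u - c) * (u - d))"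
  proof -
    have *: "(x * (p * q) - y * (q + p)) / ((p * q) * (p * q)) = (x - y / p - y / q) / (p * q)"
      if "p \<noteq> 0" "q \<noteq> 0" for x y p q :: real
      using that by (simp add: field_simps)
    show ?thesis by (rule *) (use assms in simp_all)
  qed
  finally show ?thesis unfolding 1 2 by (simp add: algebra_simps)
qed

lemma D3_cont:
  assumes "S \<subseteq> I" "c \<notin> S" "d \<notin> S"
  shows "continuous_on S (\<lambda>u. D3 u c d)"
  unfolding D3_def nrem_def
  by (intro continuous_intros continuous_on_subset[OF f_cont]) (use assms in auto)

text \<open>Unless both nodes are equal to \<open>p\<close>, the function \<open>u \<mapsto> [u, c, d]\<close> has at most a removable
  singularity at \<open>p\<close>.\<close>

lemma D3_limit:
  assumes p: "0 < p" "p < \<alpha>" and c: "c \<noteq> p" and d: "d \<in> I"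
  shows "((\<lambda>u. D3 u c d) \<longlongrightarrow> (D p d - D c d) / (p - c)) (at p)"
proof -
  have "((\<lambda>u. D u d) \<longlongrightarrow> D p d) (at p within {0<..<\<alpha>})"
    using continuous_on_subset[OF D_cont[OF d], of "{0<..<\<alpha>}"] p
    by (simp add: continuous_on_def subset_iff)
  then have "((\<lambda>u. D u d) \<longlongrightarrow> D p d) (at p)"
    using p by (subst (asm) at_within_open) auto
  then have "((\<lambda>u. (D u d - D c d) / (u - c)) \<longlongrightarrow> (D p d - D c d) / (p - c)) (at p)"
    using c by (intro tendsto_intros) auto
  moreover have "\<forall>\<^sub>F u in at p. (D u d - D c d) / (u - c) = D3 u c d"
  proof -
    have "\<forall>\<^sub>F u in at p. u \<noteq> d"
      using eventually_neq_at_within[of d p UNIV] by simp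
    then show ?thesis
      by eventually_elim (simp add: D3_sym[of _ c d] D3_eq D_sym[of c d])
  qed
  ultimately show ?thesis by (rule Lim_transform_eventually)
qed

end

section \<open>Monotonicity of second divided differences\<close>

text \<open>The conditional positivity of the Loewner matrices at \<open>N + 1\<close> points, in the equivalent form
  obtained by eliminating the coordinate that belongs to the last point \<open>u\<close>.\<close>

locale Q_fun = C1_fun +
  fixes N :: nat
  assumes Q: "\<And>c u z. (\<forall>k<N. c k \<in> I) \<Longrightarrow> u \<in> I \<Longrightarrow>
     0 \<le> (\<Sum>k<N. \<Sum>l<N. z k * z l * (D (c k) (c l) - D (c k) u - D u (c l) + f' u))"
    and N: "0 < N"
begin

text \<open>Two distinct points already force the trapezoidal rule for \<open>f'\<close> to overestimate every
  integral, which makes \<open>f'\<close> midpoint convex.\<close>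

lemma trapezoid:
  assumes "u \<in> I" "v \<in> I" "u < v"
  shows "2 * (f v - f u) \<le> (f' u + f' v) * (v - u)"
proof -
  have "0 \<le> (\<Sum>k<N. \<Sum>l<N. (if k = 0 then 1 else 0) * (if l = 0 then 1 else 0) * (D v v - D v u - D u v + f' u))"
    using Q[of "\<lambda>_. v" u "\<lambda>k. if k = 0 then 1 else 0"] assms by simp
  also have "\<dots> = (\<Sum>k<N. if k = 0 then D v v - D v u - D u v + f' u else 0)"
  proof (intro sum.cong refl)
    fix k
    have "(\<Sum>l<N. (if k = 0 then 1 else 0) * (if l = 0 then 1 else 0) * (D v v - D v u - D u v + f' u))
        = (\<Sum>l<N. if l = 0 then (if k = 0 then 1 else 0) * (D v v - D v u - D u v + f' u) else 0)"
      by (rule sum.cong) simp_all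
    then show "(\<Sum>l<N. (if k = 0 then 1 else 0) * (if l = 0 then 1 else 0) * (D v v - D v u - D u v + f' u))
        = (if k = 0 then D v v - D v u - D u v + f' u else 0)"
      using N by (simp add: sum.delta)
  qed
  also have "\<dots> = f' v + f' u - 2 * D v u"
    using N by (simp add: sum.delta D_same D_sym[of u v])
  finally have "0 \<le> (f' v + f' u - 2 * D v u) * (v - u)"
    using assms by simp
  then show ?thesis using D_mult[of v u] by (simp add: algebra_simps)
qed

lemma deriv_midpoint:
  assumes "a \<in> I" "b \<in> I" "a < b"
  shows "f' ((a + b) / 2) \<le> (f' a + f' b) / 2"
proof (rule ccontr)
  \<comment> \<open>subtract the chord of \<open>f'\<close> over \<open>[a, b]\<close>; on the largest interval around \<open>m\<close> where the
    difference \<open>g\<close> is positive, the trapezoidal rule underestimates the integral of \<open>g\<close>\<close>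
  define m where "m = (a + b) / 2"
  define r where "r = (f' b - f' a) / (b - a)"
  define g where "g t = f' t - (f' a + r * (t - a))" for t
  define G where "G t = f t - f' a * t - r * (t - a)\<^sup>2 / 2" for t
  have m: "a < m" "m < b" using assms by (auto simp: m_def)
  have sub: "{a..b} \<subseteq> I" using assms by auto
  assume neg: "\<not> ?thesis"
  have gm: "g m > 0"
  proof -
    have "r * (m - a) = (f' b - f' a) / 2" using assms by (simp add: r_def m_def field_simps)
    moreover have "f' m > (f' a + f' b) / 2" using neg by (simp add: m_def)
    ultimately show ?thesis by (simp add: g_def)
  qed
  have ga: "g a = 0" and gb: "g b = 0" using assms by (simp_all add: g_def r_def)
  have gc: "continuous_on {a..b} g"
    unfolding g_def by (intro continuous_intros continuous_on_subset[OF f'_cont sub])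
  have cl: "closed {t\<in>{a..b}. g t \<le> 0}"
    using continuous_closed_preimage[OF gc closed_atLeastAtMost closed_atMost[of 0]]
    by (simp add: vimage_def Int_def)
  have "compact ({t\<in>{a..b}. g t \<le> 0} \<inter> {a..m})" "compact ({t\<in>{a..b}. g t \<le> 0} \<inter> {m..b})"
    using cl by (auto intro: closed_Int_compact)
  moreover have "a \<in> {t\<in>{a..b}. g t \<le> 0} \<inter> {a..m}" "b \<in> {t\<in>{a..b}. g t \<le> 0} \<inter> {m..b}"
    using ga gb m assms by auto
  ultimately have
    ex: "\<exists>a1\<in>{t\<in>{a..b}. g t \<le> 0} \<inter> {a..m}. \<forall>t\<in>{t\<in>{a..b}. g t \<le> 0} \<inter> {a..m}. t \<le> a1"
      "\<exists>b1\<in>{t\<in>{a..b}. g t \<le> 0} \<inter> {m..b}. \<forall>t\<in>{t\<in>{a..b}. g t \<le> 0} \<inter> {m..b}. b1 \<le> t"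
    by (intro compact_attains_sup compact_attains_inf; blast)+
  from ex(1) obtain a1 where
    a1: "a1 \<in> {t\<in>{a..b}. g t \<le> 0} \<inter> {a..m}" "\<forall>t\<in>{t\<in>{a..b}. g t \<le> 0} \<inter> {a..m}. t \<le> a1" ..
  from ex(2) obtain b1 where
    b1: "b1 \<in> {t\<in>{a..b}. g t \<le> 0} \<inter> {m..b}" "\<forall>t\<in>{t\<in>{a..b}. g t \<le> 0} \<inter> {m..b}. b1 \<le> t" ..
  have ab1: "a1 < m" "m < b1" using a1(1) b1(1) gm by (auto simp: less_le)
  have pos: "g t > 0" if "a1 < t" "t < b1" for t
  proof (rule ccontr)
    assume "\<not> ?thesis"
    then have "g t \<le> 0" by simp
    moreover have "a \<le> t" "t \<le> b" using a1(1) b1(1) that by auto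
    ultimately have "t \<in> {t\<in>{a..b}. g t \<le> 0}" by simp
    then have "t \<le> m \<Longrightarrow> t \<le> a1" "m \<le> t \<Longrightarrow> b1 \<le> t"
      using a1(2) b1(2) \<open>a \<le> t\<close> \<open>t \<le> b\<close> by auto
    then show False using that by linarith
  qed
  have "G a1 < G b1"
  proof (rule DERIV_pos_imp_increasing_open[where f = G])
    show "a1 < b1" using ab1 by simp
    fix t assume t: "a1 < t" "t < b1"
    then have "0 < t" "t < \<alpha>" using a1(1) b1(1) sub assms by auto
    then have "(G has_real_derivative g t) (at t)"
      unfolding G_def g_def
      by (auto intro!: derivative_eq_intros has_deriv_interior simp: field_simps)
    then show "\<exists>y. (G has_real_derivative y) (at t) \<and> 0 < y" using pos t by blast
  next
    show "continuous_on {a1..b1} G"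
      unfolding G_def using a1(1) b1(1) sub
      by (intro continuous_intros continuous_on_subset[OF f_cont]) auto
  qed
  moreover have "(f' a1 + f' b1) * (b1 - a1)
      = (g a1 + g b1) * (b1 - a1) - 2 * (G b1 - G a1) + 2 * (f b1 - f a1)"
    by (simp add: g_def G_def field_simps power2_eq_square)
  then have "2 * (f b1 - f a1) \<le> (g a1 + g b1) * (b1 - a1) - 2 * (G b1 - G a1) + 2 * (f b1 - f a1)"
    using trapezoid[of a1 b1] a1(1) b1(1) ab1 sub assms by auto
  moreover have "(g a1 + g b1) * (b1 - a1) \<le> 0"
    using a1(1) b1(1) ab1 by (intro mult_nonpos_nonneg) auto
  ultimately show False by (smt (verit))
qed

lemma symmetric_difference_ge:
  assumes "0 < e" "0 < p - e" "p + e < \<alpha>"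
  shows "2 * e * f' p \<le> f (p + e) - f (p - e)"
proof -
  define h where "h x = f (p + x) - f (p - x) - 2 * x * f' p" for x
  have "h 0 \<le> h e"
  proof (rule DERIV_nonneg_imp_increasing_open[where f = h])
    fix x assume x: "0 < x" "x < e"
    have d: "((\<lambda>x. f (p + x)) has_real_derivative f' (p + x) * 1) (at x)"
      by (rule DERIV_chain2[where g = "\<lambda>x. p + x", OF has_deriv_interior])
        (use x assms in \<open>auto intro!: derivative_eq_intros\<close>)
    have d': "((\<lambda>x. f (p - x)) has_real_derivative f' (p - x) * (-1)) (at x)"
      by (rule DERIV_chain2[where g = "\<lambda>x. p - x", OF has_deriv_interior])
        (use x assms in \<open>auto intro!: derivative_eq_intros\<close>)
    have "(h has_real_derivative f' (p + x) + f' (p - x) - 2 * f' p) (at x)"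
      unfolding h_def by (rule derivative_eq_intros d d' refl | simp)+
    moreover have "f' ((p - x + (p + x)) / 2) \<le> (f' (p - x) + f' (p + x)) / 2"
      using x assms by (intro deriv_midpoint) auto
    ultimately show "\<exists>y. (h has_real_derivative y) (at x) \<and> 0 \<le> y"
      by (intro exI[of _ "f' (p + x) + f' (p - x) - 2 * f' p"]) simp
  next
    show "continuous_on {0..e} h"
      unfolding h_def using assms
      by (intro continuous_intros continuous_on_compose2[OF f_cont]) auto
  qed (use assms in simp)
  then show ?thesis by (simp add: h_def)
qed

text \<open>The quadratic form of the matrix of all \<open>[u, c\<^sub>k, c\<^sub>l]\<close> as a function of \<open>u\<close>.\<close>

definition "phi c z = (\<lambda>u. \<Sum>k<N. \<Sum>l<N. z k * z l * D3 u (c k) (c l))"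

lemma phi_mono:
  assumes c: "\<forall>k<N. c k \<in> I" and u: "0 \<le> u" "u \<le> v" "v < \<alpha>" and no: "c ` {..<N} \<inter> {u..v} = {}"
  shows "phi c z u \<le> phi c z v"
proof (rule DERIV_nonneg_imp_increasing_open[where f = "phi c z"])
  fix x assume x: "u < x" "x < v"
  have ne: "x \<noteq> c k" if "k < N" for k using no x that by auto
  have "(phi c z has_real_derivative
      (\<Sum>k<N. \<Sum>l<N. z k * z l * ((f' x - D x (c k) - D x (c l) + D (c k) (c l)) / ((x - c k) * (x - c l))))) (at x)"
    unfolding phi_def
  proof (rule DERIV_sum, rule DERIV_sum, rule DERIV_cmult)
    fix k l assume "k \<in> {..<N}" "l \<in> {..<N}"
    then show "((\<lambda>u. D3 u (c k) (c l)) has_real_derivative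
        (f' x - D x (c k) - D x (c l) + D (c k) (c l)) / ((x - c k) * (x - c l))) (at x)"
      using x u ne[of k] ne[of l] by (intro D3_has_derivative) auto
  qed
  also have "(\<Sum>k<N. \<Sum>l<N. z k * z l * ((f' x - D x (c k) - D x (c l) + D (c k) (c l)) / ((x - c k) * (x - c l))))
    = (\<Sum>k<N. \<Sum>l<N. (z k / (x - c k)) * (z l / (x - c l)) * (D (c k) (c l) - D (c k) x - D x (c l) + f' x))"
  proof (intro sum.cong refl)
    fix k l
    have "f' x - D x (c k) - D x (c l) + D (c k) (c l) = D (c k) (c l) - D (c k) x - D x (c l) + f' x"
      using D_sym[of x "c k"] by linarith
    then show "z k * z l * ((f' x - D x (c k) - D x (c l) + D (c k) (c l)) / ((x - c k) * (x - c l)))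
        = (z k / (x - c k)) * (z l / (x - c l)) * (D (c k) (c l) - D (c k) x - D x (c l) + f' x)"
      by (simp only: times_divide_eq_right times_divide_eq_left divide_divide_eq_left mult_ac)
  qed
  finally have "(phi c z has_real_derivative (\<Sum>k<N. \<Sum>l<N.
      (z k / (x - c k)) * (z l / (x - c l)) * (D (c k) (c l) - D (c k) x - D x (c l) + f' x))) (at x)" .
  moreover have "0 \<le> (\<Sum>k<N. \<Sum>l<N.
      (z k / (x - c k)) * (z l / (x - c l)) * (D (c k) (c l) - D (c k) x - D x (c l) + f' x))"
    by (rule Q[OF c]) (use x u in auto)
  ultimately show "\<exists>y. (phi c z has_real_derivative y) (at x) \<and> 0 \<le> y"
    by blast
next
  show "continuous_on {u..v} (phi c z)"
    unfolding phi_def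
  proof (rule continuous_on_sum, rule continuous_on_sum, rule continuous_on_mult[OF continuous_on_const])
    fix k l assume "k \<in> {..<N}" "l \<in> {..<N}"
    then have "c k \<notin> {u..v}" "c l \<notin> {u..v}" using no by blast+
    then show "continuous_on {u..v} (\<lambda>u. D3 u (c k) (c l))"
      using u by (intro D3_cont) auto
  qed
qed (use u in simp)

text \<open>When \<open>u\<close> crosses a node \<open>p\<close>, only the entries with \<open>c\<^sub>k = c\<^sub>l = p\<close> may jump, and they all jump
  by the same amount, which is nonnegative by convexity of \<open>f'\<close>.\<close>

lemma phi_jump:
  assumes c: "\<forall>k<N. c k \<in> I" and p: "0 < p" "p < \<alpha>" and eta: "0 < \<eta>"
  shows "\<forall>\<^sub>F e in at_right 0. phi c z (p - e) \<le> phi c z (p + e) + \<eta>"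
proof -
  define W where "W k l e = D3 (p + e) (c k) (c l) - D3 (p - e) (c k) (c l)" for k l e
  define T where "T e = (\<Sum>k<N. \<Sum>l<N. z k * z l * (if c k = p \<and> c l = p then 0 else W k l e))" for e
  define E where "E e = D3 (p + e) p p - D3 (p - e) p p" for e
  have lims: "filterlim (\<lambda>e. p + e) (at p) (at_right 0)" "filterlim (\<lambda>e. p - e) (at p) (at_right 0)"
    by (auto simp: filterlim_at eventually_at_filter intro!: tendsto_eq_intros)
  have W: "(W k l \<longlongrightarrow> 0) (at_right 0)" if kl: "k < N" "l < N" "\<not> (c k = p \<and> c l = p)" for k l
  proof -
    obtain L where "((\<lambda>u. D3 u (c k) (c l)) \<longlongrightarrow> L) (at p)"
    proof (cases "c k = p")
      case False
      then show ?thesis using D3_limit[OF p, of "c k" "c l"] c kl that by blast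
    next
      case True
      then show ?thesis using D3_limit[OF p, of "c l" "c k"] c kl that
        unfolding D3_sym[of _ "c k" "c l"] by blast
    qed
    from tendsto_diff[OF filterlim_compose[OF this lims(1)] filterlim_compose[OF this lims(2)]]
    show ?thesis by (simp add: W_def[abs_def])
  qed
  have "((\<lambda>e. z k * z l * (if c k = p \<and> c l = p then 0 else W k l e)) \<longlongrightarrow> 0) (at_right 0)"
    if "k < N" "l < N" for k l
  proof (cases "c k = p \<and> c l = p")
    case False
    then show ?thesis using tendsto_mult_right_zero[OF W[OF that False]] by (simp only: if_False)
  qed simp
  then have "(T \<longlongrightarrow> 0) (at_right 0)"
    unfolding T_def by (intro tendsto_null_sum) auto
  then have "\<forall>\<^sub>F e in at_right 0. T e > - \<eta>"
    using eta by (intro order_tendstoD) auto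
  moreover have "\<forall>\<^sub>F e in at_right 0. e < p" "\<forall>\<^sub>F e in at_right 0. e < \<alpha> - p" "\<forall>\<^sub>F e in at_right (0::real). 0 < e"
    using p by (auto simp: eventually_at_right_less intro: eventually_at_rightI[of 0 p] eventually_at_rightI[of 0 "\<alpha> - p"])
  ultimately show ?thesis
  proof eventually_elim
    case (elim e)
    have "E e = (f (p + e) - f (p - e) - 2 * e * f' p) / e\<^sup>2"
      using elim by (simp add: E_def D3_def nrem_def D_same power2_eq_square diff_divide_distrib[symmetric])
    then have E: "E e \<ge> 0" using symmetric_difference_ge[of e p] elim by simp
    have "phi c z (p + e) - phi c z (p - e) = (\<Sum>k<N. \<Sum>l<N. z k * z l * W k l e)"
      by (simp add: phi_def W_def sum_subtractf right_diff_distrib)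
    also have "\<dots> = (\<Sum>k<N. \<Sum>l<N. z k * z l * (if c k = p \<and> c l = p then 0 else W k l e)
        + (if c k = p then z k else 0) * (if c l = p then z l else 0) * E e)"
      by (intro sum.cong refl) (auto simp: W_def E_def)
    also have "\<dots> = T e + (\<Sum>k<N. if c k = p then z k else 0)\<^sup>2 * E e"
      unfolding power2_eq_square sum_product by (simp only: T_def sum.distrib sum_distrib_right)
    also have "\<dots> \<ge> T e" using E by simp
    finally show ?case using elim by linarith
  qed
qed

text \<open>Hence the form is increasing across the nodes as well, by induction on the number of nodes
  between \<open>u\<close> and \<open>v\<close>.\<close>

lemma phi_le:
  assumes c: "\<forall>k<N. c k \<in> I"
    and "0 \<le> u" "u \<le> v" "v < \<alpha>" "u \<notin> c ` {..<N}" "v \<notin> c ` {..<N}"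
  shows "phi c z u \<le> phi c z v"
  using assms(2-)
proof (induction "card (c ` {..<N} \<inter> {u..v})" arbitrary: u v rule: less_induct)
  case less
  let ?C = "c ` {..<N}"
  show ?case
  proof (cases "?C \<inter> {u..v} = {}")
    case True
    then show ?thesis using phi_mono[OF c] less by blast
  next
    case False
    then obtain p where "p \<in> ?C \<inter> {u..v}" by blast
    then have p: "p \<in> ?C" "u \<le> p" "p \<le> v" by auto
    then have p': "u < p" "p < v" using less by (auto simp: less_le)
    show ?thesis
    proof (rule field_le_epsilon)
      fix \<eta> :: real assume "0 < \<eta>"
      then have "\<forall>\<^sub>F e in at_right 0. phi c z (p - e) \<le> phi c z (p + e) + \<eta>"
        using phi_jump[OF c, of p] p' less by auto
      moreover have "\<forall>\<^sub>F e in at_right 0. e < p - u" "\<forall>\<^sub>F e in at_right 0. e < v - p"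
        "\<forall>\<^sub>F e in at_right (0::real). 0 < e"
        using p' by (auto simp: eventually_at_right_less intro: eventually_at_rightI[of 0 "p - u"] eventually_at_rightI[of 0 "v - p"])
      moreover have "\<forall>\<^sub>F e in at_right 0. \<forall>q\<in>?C. p - e \<noteq> q \<and> p + e \<noteq> q"
      proof (intro eventually_ball_finite ballI)
        fix q
        have "\<forall>\<^sub>F e in at_right 0. e \<noteq> \<bar>p - q\<bar>"
          by (rule eventually_neq_at_within)
        moreover have "\<forall>\<^sub>F e in at_right (0::real). 0 < e" by (simp add: eventually_at_right_less)
        ultimately show "\<forall>\<^sub>F e in at_right 0. p - e \<noteq> q \<and> p + e \<noteq> q"
          by eventually_elim auto
      qed simp
      ultimately have "\<forall>\<^sub>F e in at_right 0. phi c z (p - e) \<le> phi c z (p + e) + \<eta> \<and> e < p - u \<and> e < v - p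
          \<and> 0 < e \<and> (\<forall>q\<in>?C. p - e \<noteq> q \<and> p + e \<noteq> q)"
        by eventually_elim auto
      then obtain e where e: "phi c z (p - e) \<le> phi c z (p + e) + \<eta>" "e < p - u" "e < v - p" "0 < e"
        "\<forall>q\<in>?C. p - e \<noteq> q \<and> p + e \<noteq> q"
        using eventually_happens[of _ "at_right (0::real)"] by (auto simp: trivial_limit_at_right_real)
      have "p \<in> ?C \<inter> {u..v}" "p \<notin> {u..p - e}" "p \<notin> {p + e..v}" using p e by auto
      moreover have "{u..p - e} \<subseteq> {u..v}" "{p + e..v} \<subseteq> {u..v}" using p e by auto
      ultimately have "?C \<inter> {u..p - e} \<subset> ?C \<inter> {u..v}" "?C \<inter> {p + e..v} \<subset> ?C \<inter> {u..v}" by blast+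
      then have card: "card (?C \<inter> {u..p - e}) < card (?C \<inter> {u..v})"
          "card (?C \<inter> {p + e..v}) < card (?C \<inter> {u..v})"
        by (auto intro!: psubset_card_mono)
      have "phi c z u \<le> phi c z (p - e)"
        by (rule less.hyps[OF card(1)]) (use e less.prems p' in auto)
      moreover have "phi c z (p + e) \<le> phi c z v"
        by (rule less.hyps[OF card(2)]) (use e less.prems p' in auto)
      ultimately show "phi c z u \<le> phi c z v + \<eta>" using e by linarith
    qed
  qed
qed

lemma right_limit:
  assumes g: "continuous_on I g" and s: "s \<in> I" shows "(g \<longlongrightarrow> g s) (at_right s)"
proof -
  have "(g \<longlongrightarrow> g s) (at s within I)" using g s by (simp add: continuous_on_def)
  then have "(g \<longlongrightarrow> g s) (at s within {s<..<\<alpha>})"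
    by (rule tendsto_within_subset) (use s in auto)
  moreover have "at s within {s<..<\<alpha>} = at_right s"
    by (rule at_within_nhd[of s "{..<\<alpha>}"]) (use s in auto)
  ultimately show ?thesis by simp
qed

lemma nrem_quad_cont_first:
  assumes "s \<in> I"
  shows "((\<lambda>u. \<Sum>k<N. \<Sum>l<N. x k * x l * nrem u (c k) (c l))
    \<longlongrightarrow> (\<Sum>k<N. \<Sum>l<N. x k * x l * nrem s (c k) (c l))) (at_right s)"
proof -
  have "(f \<longlongrightarrow> f s) (at_right s)" by (rule right_limit[OF f_cont assms])
  then have "((\<lambda>u. nrem u a b) \<longlongrightarrow> nrem s a b) (at_right s)" for a b
    unfolding nrem_def
    by (rule tendsto_diff[OF tendsto_diff[OF _ tendsto_const] tendsto_mult[OF tendsto_const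
          tendsto_diff[OF tendsto_ident_at tendsto_const]]])
  then show ?thesis by (intro tendsto_sum tendsto_mult tendsto_const)
qed

text \<open>Nodes at the endpoint \<open>0\<close> are limits of positive nodes.\<close>

lemma nrem_max_lim:
  assumes "c \<in> I" "d \<in> I"
  shows "((\<lambda>e. nrem s (max c e) (max d e)) \<longlongrightarrow> nrem s c d) (at_right 0)"
proof -
  have \<alpha>: "0 < \<alpha>" using assms by auto
  have ev: "\<forall>\<^sub>F e in at_right 0. max c e = c" if "0 < c" for c :: real
    using that by (intro eventually_at_rightI[of 0 c]) auto
  have pos: "\<forall>\<^sub>F e in at_right 0. (0::real) < e" by (simp add: eventually_at_right_less)
  have m: "((\<lambda>e. max c e) \<longlongrightarrow> c) (at_right 0)" if "0 \<le> c" for c :: real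
    using that tendsto_max[OF tendsto_const tendsto_ident_at, of c 0 "{0<..}"] by (simp add: max_absorb1)
  have at0: "(g \<longlongrightarrow> g 0) (at_right 0)" if "continuous_on I g" for g :: "real \<Rightarrow> real"
    by (rule right_limit[OF that]) (use \<alpha> in simp)
  have fm: "((\<lambda>e. f (max c e)) \<longlongrightarrow> f c) (at_right 0)" if "c \<in> I" for c
  proof (cases "c = 0")
    case True
    have "\<forall>\<^sub>F e in at_right 0. f e = f (max c e)" using pos by eventually_elim (simp add: True)
    from Lim_transform_eventually[OF at0[OF f_cont] this] show ?thesis using True by simp
  next
    case False
    then have "\<forall>\<^sub>F e in at_right 0. max c e = c" using ev[of c] that by simp
    then have "\<forall>\<^sub>F e in at_right 0. f (max c e) = f c" by eventually_elim simp
    then show ?thesis by (rule tendsto_eventually)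
  qed
  have one: "((\<lambda>e. D (max 0 e) (max d e)) \<longlongrightarrow> D 0 d) (at_right 0)" if "0 < d" "d \<in> I" for d
  proof -
    have "\<forall>\<^sub>F e in at_right 0. D e d = D (max 0 e) (max d e)"
      using pos ev[OF that(1)] by eventually_elim (simp add: max_def)
    from Lim_transform_eventually[OF at0[OF D_cont[OF that(2)]] this] show ?thesis .
  qed
  have "((\<lambda>e. D (max c e) (max d e)) \<longlongrightarrow> D c d) (at_right 0)"
  proof -
    consider "0 < c" "0 < d" | "c = 0" "0 < d" | "0 < c" "d = 0" | "c = 0" "d = 0"
      using assms by force
    then show ?thesis
    proof cases
      case 1
      have "\<forall>\<^sub>F e in at_right 0. D (max c e) (max d e) = D c d"
        using ev[OF 1(1)] ev[OF 1(2)] by eventually_elim simp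
      then show ?thesis by (rule tendsto_eventually)
    next
      case 2
      then show ?thesis using one[of d] assms by simp
    next
      case 3
      then have "((\<lambda>e. D (max d e) (max c e)) \<longlongrightarrow> D d c) (at_right 0)"
        using one[of c] assms by simp
      then show ?thesis unfolding D_sym[of d c] by (subst D_sym)
    next
      case 4
      have "\<forall>\<^sub>F e in at_right 0. f' e = D (max c e) (max d e)"
        using pos by eventually_elim (simp add: 4 D_same)
      from Lim_transform_eventually[OF at0[OF f'_cont] this] show ?thesis
        unfolding 4 D_same .
    qed
  qed
  moreover have "((\<lambda>e. max c e) \<longlongrightarrow> c) (at_right 0)" using m[of c] assms by simp
  ultimately show ?thesis unfolding nrem_def
    using fm[OF assms(1)] by (intro tendsto_diff tendsto_mult tendsto_const)
qed

text \<open>Positivity of the matrices \<open>[0, c\<^sub>k, c\<^sub>l]\<close> propagates from \<open>0\<close> to every point \<open>s\<close>. The remainder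
  absorbs the factors \<open>(s - c\<^sub>k) (s - c\<^sub>l)\<close>, so the exceptional positions, where \<open>s\<close> is a node or a
  node is \<open>0\<close>, follow by continuity.\<close>

theorem nrem_nonneg:
  assumes L: "\<And>c z. (\<forall>k<N. 0 < c k \<and> c k < \<alpha>) \<Longrightarrow> 0 \<le> (\<Sum>k<N. \<Sum>l<N. z k * z l * D3 0 (c k) (c l))"
    and s: "s \<in> I" and c: "\<forall>k<N. c k \<in> I"
  shows "0 \<le> (\<Sum>k<N. \<Sum>l<N. x k * x l * nrem s (c k) (c l))"
proof -
  \<comment> \<open>positive nodes, and \<open>u > 0\<close> not a node\<close>
  have 1: "0 \<le> (\<Sum>k<N. \<Sum>l<N. x k * x l * nrem u (c k) (c l))"
    if c: "\<forall>k<N. 0 < c k \<and> c k < \<alpha>" and u: "0 < u" "u < \<alpha>" "u \<notin> c ` {..<N}" for c u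
  proof -
    define z where "z k = (u - c k) * x k" for k
    have "0 \<le> phi c z 0" unfolding phi_def by (rule L[OF c])
    also have "\<dots> \<le> phi c z u"
      by (rule phi_le) (use c u in auto)
    also have "\<dots> = (\<Sum>k<N. \<Sum>l<N. x k * x l * nrem u (c k) (c l))"
      unfolding phi_def z_def
    proof (intro sum.cong refl)
      fix k l assume "k \<in> {..<N}" "l \<in> {..<N}"
      then have "u \<noteq> c k" "u \<noteq> c l" using u by auto
      then show "(u - c k) * x k * ((u - c l) * x l) * D3 u (c k) (c l) = x k * x l * nrem u (c k) (c l)"
        by (simp add: nrem_eq_D3)
    qed
    finally show ?thesis .
  qed
  \<comment> \<open>positive nodes, and \<open>s\<close> arbitrary: let \<open>u\<close> decrease to \<open>s\<close>\<close>
  have 2: "0 \<le> (\<Sum>k<N. \<Sum>l<N. x k * x l * nrem s (c k) (c l))"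
    if c: "\<forall>k<N. 0 < c k \<and> c k < \<alpha>" for c
  proof (rule tendsto_lowerbound[OF nrem_quad_cont_first[OF s]])
    have "\<forall>\<^sub>F u in at_right s. \<forall>q\<in>c ` {..<N}. u \<noteq> q"
      by (intro eventually_ball_finite ballI eventually_neq_at_within) simp
    moreover have "\<forall>\<^sub>F u in at_right s. s < u" "\<forall>\<^sub>F u in at_right s. u < \<alpha>"
      using s by (auto simp: eventually_at_right_less intro: eventually_at_rightI[of s \<alpha>])
    ultimately show "\<forall>\<^sub>F u in at_right s. 0 \<le> (\<Sum>k<N. \<Sum>l<N. x k * x l * nrem u (c k) (c l))"
    proof eventually_elim
      case (elim u)
      then show ?case using s by (intro 1 c) auto
    qed
  qed simp
  \<comment> \<open>nodes at \<open>0\<close>: move them to \<open>e\<close> and let \<open>e\<close> decrease to \<open>0\<close>\<close>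
  have "((\<lambda>e. \<Sum>k<N. \<Sum>l<N. x k * x l * nrem s (max (c k) e) (max (c l) e))
      \<longlongrightarrow> (\<Sum>k<N. \<Sum>l<N. x k * x l * nrem s (c k) (c l))) (at_right 0)"
    by (intro tendsto_sum tendsto_mult tendsto_const nrem_max_lim) (use c in auto)
  then show ?thesis
  proof (rule tendsto_lowerbound)
    have "\<forall>\<^sub>F e in at_right 0. e < \<alpha>" "\<forall>\<^sub>F e in at_right (0::real). 0 < e"
      using s by (auto simp: eventually_at_right_less intro: eventually_at_rightI[of 0 \<alpha>])
    then show "\<forall>\<^sub>F e in at_right 0. 0 \<le> (\<Sum>k<N. \<Sum>l<N. x k * x l * nrem s (max (c k) e) (max (c l) e))"
    proof eventually_elim
      case (elim e)
      then show ?case using c by (intro 2) auto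
    qed
  qed simp
qed

end

section \<open>Vectors, inner products and hermitian matrices\<close>

text \<open>Vectors in \<open>\<complex>\<^sup>N\<close> are represented by functions on the natural numbers of which only the values
  below \<open>N\<close> matter. All pairings are instances of one bilinear form \<open>lin\<close>: the inner product \<open>ip\<close>
  (conjugate linear in the first argument) and the components of a matrix-vector product \<open>app\<close>.\<close>

definition lin :: "nat \<Rightarrow> (nat \<Rightarrow> complex) \<Rightarrow> (nat \<Rightarrow> complex) \<Rightarrow> complex" where
  "lin N q x = (\<Sum>l<N. q l * x l)"

abbreviation ip :: "nat \<Rightarrow> (nat \<Rightarrow> complex) \<Rightarrow> (nat \<Rightarrow> complex) \<Rightarrow> complex" where
  "ip N x y \<equiv> lin N (\<lambda>l. cnj (x l)) y"

abbreviation app :: "nat \<Rightarrow> complex mat \<Rightarrow> (nat \<Rightarrow> complex) \<Rightarrow> nat \<Rightarrow> complex" where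
  "app N A x l \<equiv> lin N (\<lambda>m. A $$ (l, m)) x"

lemma lin_cong: "(\<And>l. l < N \<Longrightarrow> q l = q' l) \<Longrightarrow> (\<And>l. l < N \<Longrightarrow> x l = x' l) \<Longrightarrow> lin N q x = lin N q' x'"
  unfolding lin_def by (rule sum.cong) auto

lemma lin_diff: "lin N q (\<lambda>l. x l - y l) = lin N q x - lin N q y"
  by (simp add: lin_def right_diff_distrib sum_subtractf)

lemma lin_add: "lin N q (\<lambda>l. x l + y l) = lin N q x + lin N q y"
  by (simp add: lin_def distrib_left sum.distrib)

lemma lin_scale: "lin N q (\<lambda>l. c * x l) = c * lin N q x"
  by (simp add: lin_def sum_distrib_left mult_ac)

lemma lin_sum: "lin N q (\<lambda>l. \<Sum>j<k. c j * y j l) = (\<Sum>j<k. c j * lin N q (y j))"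
proof -
  have "lin N q (\<lambda>l. \<Sum>j<k. c j * y j l) = (\<Sum>l<N. \<Sum>j<k. c j * (q l * y j l))"
    by (simp add: lin_def sum_distrib_left mult_ac)
  also have "\<dots> = (\<Sum>j<k. c j * lin N q (y j))"
    unfolding lin_def sum_distrib_left by (rule sum.swap)
  finally show ?thesis .
qed

lemma lin_lin: "lin N q (\<lambda>l. lin N (B l) x) = lin N (\<lambda>m. lin N q (\<lambda>l. B l m)) x"
proof -
  have "lin N q (\<lambda>l. lin N (B l) x) = (\<Sum>l<N. \<Sum>m<N. q l * B l m * x m)"
    by (simp add: lin_def sum_distrib_left mult_ac)
  also have "\<dots> = (\<Sum>m<N. \<Sum>l<N. q l * B l m * x m)"
    by (rule sum.swap)
  finally show ?thesis by (simp add: lin_def sum_distrib_right)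
qed

lemma cnj_ip: "cnj (ip N x y) = ip N y x"
  by (simp add: lin_def mult.commute)

lemma ip_self: "ip N x x = complex_of_real (\<Sum>l<N. (cmod (x l))\<^sup>2)"
  unfolding lin_def of_real_sum
  by (intro sum.cong refl) (metis complex_norm_square mult.commute of_real_power)

lemma ip_self_eq_0: "ip N x x = 0 \<Longrightarrow> l < N \<Longrightarrow> x l = 0"
  unfolding ip_self of_real_eq_0_iff by (subst (asm) sum_nonneg_eq_0_iff) auto

lemma ip_scale_left: "ip N (\<lambda>l. c * x l) y = cnj c * ip N x y"
  by (simp add: lin_def sum_distrib_left mult_ac)

lemma ip_app:
  assumes "\<And>l m. l < N \<Longrightarrow> m < N \<Longrightarrow> A $$ (m, l) = cnj (A $$ (l, m))"
  shows "ip N x (app N A y) = ip N (app N A x) y"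
proof -
  have "ip N x (app N A y) = lin N (\<lambda>m. ip N x (\<lambda>l. A $$ (l, m))) y"
    by (rule lin_lin)
  also have "\<dots> = ip N (app N A x) y"
  proof (rule lin_cong)
    fix m assume "m < N"
    then have "cnj (app N A x m) = (\<Sum>l<N. cnj (x l) * A $$ (l, m))"
      unfolding lin_def cnj_sum
    proof (intro sum.cong refl)
      fix l assume "l \<in> {..<N}"
      then have "A $$ (l, m) = cnj (A $$ (m, l))" using assms[of m l] \<open>m < N\<close> by simp
      then show "cnj (A $$ (m, l) * x l) = cnj (x l) * A $$ (l, m)" by simp
    qed
    then show "ip N x (\<lambda>l. A $$ (l, m)) = cnj (app N A x m)" by (simp add: lin_def)
  qed simp
  finally show ?thesis .
qed

text \<open>The vectors \<open>u 0, \<dots>, u (N - 1)\<close> are orthonormal and satisfy the completeness relation. Either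
  condition implies the other, but both are used.\<close>

definition orthonormal_basis :: "nat \<Rightarrow> (nat \<Rightarrow> nat \<Rightarrow> complex) \<Rightarrow> bool" where
  "orthonormal_basis N u \<longleftrightarrow>
     (\<forall>i<N. \<forall>j<N. ip N (u i) (u j) = (if i = j then 1 else 0)) \<and>
     (\<forall>l<N. \<forall>m<N. (\<Sum>j<N. u j l * cnj (u j m)) = (if l = m then 1 else 0))"

text \<open>\<open>A\<close> is the sum of the rank one projections onto the \<open>u j\<close> with real weights \<open>d j\<close>. The
  eigenvalues are not required to be distinct or ordered.\<close>

definition eigensystem :: "nat \<Rightarrow> (nat \<Rightarrow> nat \<Rightarrow> complex) \<Rightarrow> (nat \<Rightarrow> real) \<Rightarrow> complex mat \<Rightarrow> bool" where
  "eigensystem N u d A \<longleftrightarrow> A \<in> carrier_mat N N \<and> orthonormal_basis N u \<and>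
     (\<forall>l<N. \<forall>m<N. A $$ (l, m) = (\<Sum>j<N. complex_of_real (d j) * (u j l * cnj (u j m))))"

lemma eigensystem_entry:
  assumes "eigensystem N u d A" "l < N" "m < N"
  shows "A $$ (l, m) = (\<Sum>j<N. complex_of_real (d j) * (u j l * cnj (u j m)))"
  using assms by (simp add: eigensystem_def)

lemma mat_adjoint_index:
  fixes A :: "complex mat"
  shows "i < dim_col A \<Longrightarrow> j < dim_row A \<Longrightarrow> mat_adjoint A $$ (i, j) = cnj (A $$ (j, i))"
  by (simp add: mat_adjoint_def mat_of_rows_index)

lemma hermitian_iff:
  assumes "A \<in> carrier_mat N N"
  shows "hermitian A \<longleftrightarrow> (\<forall>l<N. \<forall>m<N. A $$ (m, l) = cnj (A $$ (l, m)))"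
proof -
  have "hermitian A \<longleftrightarrow> mat_adjoint A = A" using assms by (auto simp: hermitian_def)
  also have "\<dots> \<longleftrightarrow> (\<forall>m<N. \<forall>l<N. mat_adjoint A $$ (m, l) = A $$ (m, l))"
    using assms mat_adjoint_carrier[OF assms] unfolding mat_eq_iff by auto
  also have "\<dots> \<longleftrightarrow> (\<forall>m<N. \<forall>l<N. cnj (A $$ (l, m)) = A $$ (m, l))"
    using assms by (simp add: mat_adjoint_index)
  finally show ?thesis by (metis (lifting))
qed

lemma hermitian_index:
  assumes "A \<in> carrier_mat N N" "hermitian A" "l < N" "m < N"
  shows "cnj (A $$ (l, m)) = A $$ (m, l)"
  using hermitian_iff[OF assms(1)] assms(2-4) by metis

section \<open>The spectral theorem\<close>

text \<open>Let \<open>A = P B Q\<close> with \<open>B\<close> upper triangular and \<open>Q\<close> inverse to \<open>P\<close>. The columns of \<open>P\<close> span an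
  \<open>A\<close>-invariant flag, and orthonormalizing them along the flag yields eigenvectors of the hermitian
  matrix \<open>A\<close>. Membership of \<open>x\<close> in the span of the first \<open>k\<close> columns is expressed by the vanishing of
  the components of \<open>Q x\<close> from \<open>k\<close> on.\<close>

lemma eigenflag:
  assumes A: "A \<in> carrier_mat N N" and herm: "hermitian A"
    and sim: "similar_mat_wit A B P Q" and B: "upper_triangular B" and k: "k \<le> N"
  shows "\<exists>v d. (\<forall>i<k. \<forall>j<k. ip N (v i) (v j) = (if i = j then 1 else 0))
     \<and> (\<forall>j<k. \<forall>l<N. app N A (v j) l = complex_of_real (d j) * v j l)
     \<and> (\<forall>j<k. \<forall>m<N. k \<le> m \<longrightarrow> app N Q (v j) m = 0)
     \<and> (\<forall>x. (\<forall>m<N. k \<le> m \<longrightarrow> app N Q x m = 0) \<longrightarrow>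
            (\<forall>l<N. x l = (\<Sum>j<k. ip N (v j) x * v j l)))"
  using k
proof (induction k)
  case 0
  from sim A have c: "P \<in> carrier_mat N N" "Q \<in> carrier_mat N N" and PQ: "P * Q = 1\<^sub>m N"
    by (auto simp: similar_mat_wit_def Let_def)
  have "x l = 0" if x: "\<forall>m<N. app N Q x m = 0" and l: "l < N" for x l
  proof -
    have "x l = app N (P * Q) x l"
      using l by (simp add: PQ lin_def if_distrib if_distribR sum.delta cong: if_cong)
    also have "\<dots> = lin N (\<lambda>r. P $$ (l, r)) (app N Q x)"
      unfolding lin_lin using c l
      by (intro lin_cong) (auto simp: lin_def scalar_prod_def atLeast0LessThan)
    also have "\<dots> = 0" using x by (simp add: lin_def)
    finally show ?thesis .
  qed
  then show ?case by auto
next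
  case (Suc k)
  from sim A have c: "P \<in> carrier_mat N N" "Q \<in> carrier_mat N N" "B \<in> carrier_mat N N"
    and PQ: "P * Q = 1\<^sub>m N" "Q * P = 1\<^sub>m N" and APBQ: "A = P * B * Q"
    by (auto simp: similar_mat_wit_def Let_def)
  have h: "\<And>l m. l < N \<Longrightarrow> m < N \<Longrightarrow> A $$ (m, l) = cnj (A $$ (l, m))"
    using herm hermitian_iff[OF A] by blast
  have "k \<le> N" using Suc.prems by simp
  from Suc.IH[OF this] obtain v d where
    orth': "\<forall>i<k. \<forall>j<k. ip N (v i) (v j) = (if i = j then 1 else 0)" and
    eig': "\<forall>j<k. \<forall>l<N. app N A (v j) l = complex_of_real (d j) * v j l" and
    flag': "\<forall>j<k. \<forall>m<N. k \<le> m \<longrightarrow> app N Q (v j) m = 0" and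
    span': "\<forall>x. (\<forall>m<N. k \<le> m \<longrightarrow> app N Q x m = 0) \<longrightarrow> (\<forall>l<N. x l = (\<Sum>j<k. ip N (v j) x * v j l))"
    by (elim exE conjE)
  have orth: "\<And>i j. i < k \<Longrightarrow> j < k \<Longrightarrow> ip N (v i) (v j) = (if i = j then 1 else 0)" using orth' by blast
  have eig: "\<And>j l. j < k \<Longrightarrow> l < N \<Longrightarrow> app N A (v j) l = complex_of_real (d j) * v j l" using eig' by blast
  have flag: "\<And>j m. j < k \<Longrightarrow> m < N \<Longrightarrow> k \<le> m \<Longrightarrow> app N Q (v j) m = 0" using flag' by blast
  have span: "\<And>x l. (\<And>m. m < N \<Longrightarrow> k \<le> m \<Longrightarrow> app N Q x m = 0) \<Longrightarrow> l < N \<Longrightarrow> x l = (\<Sum>j<k. ip N (v j) x * v j l)"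
    using span' by blast
  have kN: "k < N" using Suc by simp
  \<comment> \<open>\<open>q\<close> is the new column \<open>p\<close> made orthogonal to the previous eigenvectors. The vector
    \<open>r = A q - b q\<close> is orthogonal to them since \<open>A\<close> is hermitian, and it lies in their span since
    \<open>B\<close> is triangular with diagonal entry \<open>b\<close>. So \<open>r = 0\<close>.\<close>
  define p where "p l = P $$ (l, k)" for l
  define b where "b = B $$ (k, k)"
  define q where "q l = p l - (\<Sum>j<k. ip N (v j) p * v j l)" for l
  define r where "r l = app N A q l - b * q l" for l
  have Qp: "app N Q p m = (if m = k then 1 else 0)" if "m < N" for m
  proof -
    have "app N Q p m = (Q * P) $$ (m, k)"
      using that kN c by (simp add: lin_def p_def scalar_prod_def atLeast0LessThan)
    then show ?thesis using that kN by (simp add: PQ)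
  qed
  have QAp: "app N Q (app N A p) m = B $$ (m, k)" if "m < N" for m
  proof -
    have "A * P = P * B"
      unfolding APBQ using c PQ by (simp add: assoc_mult_mat[of _ N N _ N _ N])
    then have "Q * (A * P) = B"
      using c PQ assoc_mult_mat[of Q N N P N B N] by simp
    then have "B $$ (m, k) = (Q * (A * P)) $$ (m, k)" by simp
    also have "\<dots> = app N Q (app N A p) m"
      using that kN c A by (simp add: lin_def p_def scalar_prod_def atLeast0LessThan)
    finally show ?thesis by simp
  qed
  have Qq: "app N Q q m = (if m = k then 1 else 0)" if "m < N" "k \<le> m" for m
    unfolding q_def lin_diff lin_sum using Qp flag that by simp
  have Aq: "app N A q l = app N A p l - (\<Sum>j<k. (ip N (v j) p * complex_of_real (d j)) * v j l)" if "l < N" for l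
    unfolding q_def lin_diff lin_sum using that eig by (simp add: mult.assoc)
  have Qr: "app N Q r m = 0" if m: "m < N" "k \<le> m" for m
  proof -
    have "app N Q (app N A q) m
        = app N Q (\<lambda>l. app N A p l - (\<Sum>j<k. (ip N (v j) p * complex_of_real (d j)) * v j l)) m"
      by (rule lin_cong) (simp_all add: Aq)
    also have "\<dots> = B $$ (m, k)"
      unfolding lin_diff lin_sum using flag m QAp by simp
    finally have "app N Q r m = B $$ (m, k) - b * (if m = k then 1 else 0)"
      unfolding r_def lin_diff lin_scale using Qq m by simp
    then show ?thesis
      using B m c by (auto simp: b_def upper_triangular_def)
  qed
  have vq: "ip N (v j) q = 0" if "j < k" for j
  proof -
    have "(\<Sum>i<k. ip N (v i) p * ip N (v j) (v i)) = (\<Sum>i<k. if i = j then ip N (v j) p else 0)"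
      using orth that by (intro sum.cong refl) simp
    then show ?thesis unfolding q_def lin_diff lin_sum using that by (simp add: sum.delta)
  qed
  have "ip N (v j) r = 0" if j: "j < k" for j
  proof -
    have "ip N (v j) (app N A q) = ip N (app N A (v j)) q" by (rule ip_app[OF h])
    also have "\<dots> = ip N (\<lambda>l. complex_of_real (d j) * v j l) q"
      by (rule lin_cong) (simp_all add: eig j)
    also have "\<dots> = 0" unfolding ip_scale_left using vq[OF j] by simp
    finally show ?thesis unfolding r_def lin_diff lin_scale using vq[OF j] by simp
  qed
  then have "r l = 0" if "l < N" for l using span[of r l] Qr that by simp
  then have eigq: "app N A q l = b * q l" if "l < N" for l using that by (simp add: r_def)
  define s where "s = (\<Sum>l<N. (cmod (q l))\<^sup>2)"
  have qq: "ip N q q = complex_of_real s" unfolding s_def by (rule ip_self)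
  have "s \<noteq> 0"
  proof
    assume "s = 0"
    then have "q l = 0" if "l < N" for l using ip_self_eq_0[of N q l] qq that by simp
    then have "app N Q q k = 0" by (simp add: lin_def)
    then show False using Qq[of k] kN by simp
  qed
  moreover have "s \<ge> 0" unfolding s_def by (intro sum_nonneg) auto
  ultimately have s: "s > 0" by simp
  have "b * complex_of_real s = ip N q (app N A q)"
    by (simp add: lin_cong[OF refl eigq] lin_scale qq)
  also have "\<dots> = ip N (app N A q) q" by (rule ip_app[OF h])
  also have "\<dots> = cnj b * complex_of_real s"
    using lin_cong[of N "\<lambda>l. cnj (app N A q l)" "\<lambda>l. cnj (b * q l)" q q] eigq ip_scale_left[of N b q q] qq
    by simp
  finally have b: "b = complex_of_real (Re b)" using s by (simp add: complex_eq_iff)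
  define t where "t = complex_of_real (1 / sqrt s)"
  have t: "cnj t = t" "t * t * complex_of_real s = 1" "t \<noteq> 0"
    using s by (auto simp: t_def field_simps simp flip: of_real_mult)
  define v' where "v' = v(k := \<lambda>l. t * q l)"
  define d' where "d' = d(k := Re b)"
  have v': "v' j = v j" if "j < k" for j using that by (simp add: v'_def)
  have v'k: "v' k = (\<lambda>l. t * q l)" by (simp add: v'_def)
  show ?case
  proof (intro exI conjI allI impI)
    fix i j assume "i < Suc k" "j < Suc k"
    then consider "i < k" "j < k" | "i < k" "j = k" | "i = k" "j < k" | "i = k" "j = k" by linarith
    then show "ip N (v' i) (v' j) = (if i = j then 1 else 0)"
    proof cases
      case 1 then show ?thesis by (simp add: v' orth)
    next
      case 2 then show ?thesis by (simp add: v' v'k lin_scale vq)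
    next
      case 3
      then show ?thesis using vq[of j] cnj_ip[of N "v j" q] by (simp add: v' v'k ip_scale_left del: complex_cnj_mult)
    next
      case 4 then show ?thesis using t qq by (simp add: v'k ip_scale_left lin_scale mult.assoc del: complex_cnj_mult)
    qed
  next
    fix j l assume "j < Suc k" and l: "l < N"
    then show "app N A (v' j) l = complex_of_real (d' j) * v' j l"
      using b eigq[OF l] eig[OF _ l] by (cases "j = k") (simp_all add: v'k v' d'_def lin_scale)
  next
    fix j m assume "j < Suc k" "m < N" "Suc k \<le> m"
    then show "app N Q (v' j) m = 0"
      using Qq[of m] flag[of j m] by (cases "j = k") (simp_all add: v'k v' lin_scale)
  next
    fix x l assume x: "\<forall>m<N. Suc k \<le> m \<longrightarrow> app N Q x m = 0" and l: "l < N"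
    define a where "a = app N Q x k"
    have "app N Q (\<lambda>l. x l - a * q l) m = 0" if "m < N" "k \<le> m" for m
      unfolding lin_diff lin_scale using Qq[OF that] x that
      by (cases "m = k") (simp_all add: a_def)
    moreover have vx: "ip N (v j) (\<lambda>l. x l - a * q l) = ip N (v j) x" if "j < k" for j
      unfolding lin_diff lin_scale using vq[OF that] by simp
    ultimately have xr: "x l - a * q l = (\<Sum>j<k. ip N (v j) x * v j l)" if "l < N" for l
      using span[of "\<lambda>l. x l - a * q l" l] that by simp
    have "ip N q x = ip N q (\<lambda>l. a * q l + (\<Sum>j<k. ip N (v j) x * v j l))"
      by (rule lin_cong) (simp_all flip: xr)
    also have "\<dots> = a * complex_of_real s"
    proof -
      have "ip N q (v j) = 0" if "j < k" for j using vq[OF that] cnj_ip[of N "v j" q] by simp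
      then have "(\<Sum>j<k. ip N (v j) x * ip N q (v j)) = 0" by (intro sum.neutral) simp
      then show ?thesis unfolding lin_add lin_scale lin_sum qq by simp
    qed
    finally have "ip N (v' k) x * v' k l = a * q l"
    proof -
      assume "ip N q x = a * complex_of_real s"
      then have "ip N (v' k) x * v' k l = (t * t * complex_of_real s) * (a * q l)"
        unfolding v'k ip_scale_left t(1) by (simp add: mult_ac)
      then show ?thesis using t(2) by simp
    qed
    then show "x l = (\<Sum>j<Suc k. ip N (v' j) x * v' j l)"
      using xr[OF l] by (simp add: v' algebra_simps)
  qed
qed

theorem hermitian_eigensystem:
  assumes A: "A \<in> carrier_mat N N" and herm: "hermitian A"
  shows "\<exists>u d. eigensystem N u d A"
proof -
  obtain es where es: "char_poly A = (\<Prod>e\<leftarrow>es. [:- e, 1:])"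
    using char_poly_factorized[OF A] by blast
  obtain B P Q where "schur_decomposition A es = (B, P, Q)" by (cases "schur_decomposition A es")
  then have "similar_mat_wit A B P Q" "upper_triangular B"
    using schur_decomposition[OF A es] by auto
  from eigenflag[OF A herm this le_refl] obtain v d where
    orth: "\<forall>i<N. \<forall>j<N. ip N (v i) (v j) = (if i = j then 1 else 0)" and
    eig': "\<forall>j<N. \<forall>l<N. app N A (v j) l = complex_of_real (d j) * v j l" and
    span': "\<forall>x. (\<forall>m<N. N \<le> m \<longrightarrow> app N Q x m = 0) \<longrightarrow> (\<forall>l<N. x l = (\<Sum>j<N. ip N (v j) x * v j l))"
    by (elim exE conjE)
  have eig: "\<And>j l. j < N \<Longrightarrow> l < N \<Longrightarrow> app N A (v j) l = complex_of_real (d j) * v j l" using eig' by blast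
  have span: "\<And>x l. l < N \<Longrightarrow> x l = (\<Sum>j<N. ip N (v j) x * v j l)" using span' by auto
  have compl: "(\<Sum>j<N. v j l * cnj (v j m)) = (if l = m then 1 else 0)" if "l < N" "m < N" for l m
  proof -
    let ?e = "\<lambda>r. if r = m then 1 else 0"
    have "ip N (v j) ?e = cnj (v j m)" for j
      using that(2) by (simp add: lin_def if_distrib sum.delta cong: if_cong)
    then have "(\<Sum>j<N. v j l * cnj (v j m)) = (\<Sum>j<N. ip N (v j) ?e * v j l)"
      by (simp add: mult.commute)
    also have "\<dots> = ?e l" by (rule span[OF that(1), symmetric])
    finally show ?thesis .
  qed
  have "A $$ (l, m) = (\<Sum>j<N. complex_of_real (d j) * (v j l * cnj (v j m)))" if "l < N" "m < N" for l m
  proof -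
    have "(\<Sum>j<N. complex_of_real (d j) * (v j l * cnj (v j m))) = (\<Sum>j<N. cnj (v j m) * app N A (v j) l)"
      using eig that by (intro sum.cong refl) simp
    also have "\<dots> = lin N (\<lambda>r. A $$ (l, r)) (\<lambda>r. \<Sum>j<N. cnj (v j m) * v j r)"
      by (simp add: lin_sum)
    also have "\<dots> = lin N (\<lambda>r. A $$ (l, r)) (\<lambda>r. if r = m then 1 else 0)"
      using compl that by (intro lin_cong) (simp_all add: mult.commute)
    also have "\<dots> = A $$ (l, m)"
      using that by (simp add: lin_def if_distrib sum.delta cong: if_cong)
    finally show ?thesis by simp
  qed
  moreover have "orthonormal_basis N v" unfolding orthonormal_basis_def using orth compl by simp
  ultimately have "eigensystem N v d A" unfolding eigensystem_def using A by simp
  then show ?thesis by blast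
qed

section \<open>Sesquilinear forms and functional calculus\<close>

text \<open>The sesquilinear form \<open>\<langle>x, A y\<rangle>\<close> of a matrix.\<close>

definition sform :: "nat \<Rightarrow> complex mat \<Rightarrow> (nat \<Rightarrow> complex) \<Rightarrow> (nat \<Rightarrow> complex) \<Rightarrow> complex" where
  "sform N A x y = (\<Sum>l<N. \<Sum>m<N. cnj (x l) * A $$ (l, m) * y m)"

lemma sesquilinear_expand:
  "(\<Sum>l<N. \<Sum>m<N. cnj (x l) * (\<Sum>j<k. e j * (u j l * cnj (u j m))) * y m)
     = (\<Sum>j<k. e j * (cnj (ip N (u j) x) * ip N (u j) y))"
proof -
  let ?T = "\<lambda>j l m. e j * (u j l * cnj (x l)) * (cnj (u j m) * y m)"
  have "(\<Sum>l<N. \<Sum>m<N. cnj (x l) * (\<Sum>j<k. e j * (u j l * cnj (u j m))) * y m)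
      = (\<Sum>l<N. \<Sum>m<N. \<Sum>j<k. ?T j l m)"
    by (intro sum.cong refl) (simp only: sum_distrib_left sum_distrib_right mult_ac)
  also have "\<dots> = (\<Sum>l<N. \<Sum>j<k. \<Sum>m<N. ?T j l m)"
    by (intro sum.cong refl sum.swap)
  also have "\<dots> = (\<Sum>j<k. \<Sum>l<N. \<Sum>m<N. ?T j l m)"
    by (rule sum.swap)
  also have "\<dots> = (\<Sum>j<k. e j * (cnj (ip N (u j) x) * ip N (u j) y))"
  proof (rule sum.cong[OF refl])
    fix j
    have "cnj (ip N (u j) x) = (\<Sum>l<N. u j l * cnj (x l))" by (simp add: lin_def)
    then have "cnj (ip N (u j) x) * ip N (u j) y = (\<Sum>l<N. \<Sum>m<N. u j l * cnj (x l) * (cnj (u j m) * y m))"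
      by (simp only: lin_def sum_product)
    then show "(\<Sum>l<N. \<Sum>m<N. ?T j l m) = e j * (cnj (ip N (u j) x) * ip N (u j) y)"
      by (simp only: sum_distrib_left mult.assoc)
  qed
  finally show ?thesis .
qed

lemma sform_eigensystem:
  assumes "eigensystem N u d A"
  shows "sform N A x y = (\<Sum>j<N. complex_of_real (d j) * (cnj (ip N (u j) x) * ip N (u j) y))"
  unfolding sesquilinear_expand[symmetric] sform_def
  using assms by (intro sum.cong refl) (simp add: eigensystem_def)

lemma parseval:
  assumes "orthonormal_basis N u"
  shows "ip N x y = (\<Sum>j<N. cnj (ip N (u j) x) * ip N (u j) y)"
proof -
  have "(\<Sum>j<N. cnj (ip N (u j) x) * ip N (u j) y)
      = (\<Sum>l<N. \<Sum>m<N. cnj (x l) * (\<Sum>j<N. 1 * (u j l * cnj (u j m))) * y m)"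
    unfolding sesquilinear_expand by simp
  also have "\<dots> = (\<Sum>l<N. \<Sum>m<N. if m = l then cnj (x l) * y l else 0)"
    using assms by (intro sum.cong refl) (simp add: orthonormal_basis_def)
  also have "\<dots> = ip N x y" by (simp add: lin_def)
  finally show ?thesis by simp
qed

lemma unitary_conj_diag_index:
  fixes U :: "complex mat"
  assumes "U \<in> carrier_mat N N" "l < N" "m < N"
  shows "(U * mat_diag N e * mat_adjoint U) $$ (l, m) = (\<Sum>j<N. e j * (U $$ (l, j) * cnj (U $$ (m, j))))"
  using assms mat_adjoint_carrier[OF assms(1)]
  by (simp add: mat_diag_mult_right[OF assms(1)] scalar_prod_def mat_adjoint_index atLeast0LessThan mult_ac)

lemma eigensystem_diagonalizes:
  assumes "eigensystem N u d A"
  shows "diagonalizes (mat N N (\<lambda>(l, j). u j l)) d A"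
proof -
  define U where "U = mat N N (\<lambda>(l, j). u j l)"
  have U: "U \<in> carrier_mat N N" by (simp add: U_def)
  have A: "A \<in> carrier_mat N N" and
    o: "\<And>i j. i < N \<Longrightarrow> j < N \<Longrightarrow> ip N (u i) (u j) = (if i = j then 1 else 0)"
    "\<And>l m. l < N \<Longrightarrow> m < N \<Longrightarrow> (\<Sum>j<N. u j l * cnj (u j m)) = (if l = m then 1 else 0)" and
    e: "\<And>l m. l < N \<Longrightarrow> m < N \<Longrightarrow> A $$ (l, m) = (\<Sum>j<N. complex_of_real (d j) * (u j l * cnj (u j m)))"
    using assms unfolding eigensystem_def orthonormal_basis_def by blast+
  note c = U mat_adjoint_carrier[OF U]
  have "mat_adjoint U * U = 1\<^sub>m N"
  proof (rule eq_matI)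
    fix i j assume "i < dim_row (1\<^sub>m N :: complex mat)" "j < dim_col (1\<^sub>m N :: complex mat)"
    then have ij: "i < N" "j < N" by auto
    then have "(mat_adjoint U * U) $$ (i, j) = ip N (u i) (u j)"
      using c by (simp add: scalar_prod_def mat_adjoint_index atLeast0LessThan lin_def) (simp add: U_def)
    then show "(mat_adjoint U * U) $$ (i, j) = 1\<^sub>m N $$ (i, j)"
      unfolding o(1)[OF ij] using ij by simp
  qed (use c in auto)
  moreover have "U * mat_adjoint U = 1\<^sub>m N"
  proof (rule eq_matI)
    fix i j assume "i < dim_row (1\<^sub>m N :: complex mat)" "j < dim_col (1\<^sub>m N :: complex mat)"
    then have ij: "i < N" "j < N" by auto
    then have "(U * mat_adjoint U) $$ (i, j) = (\<Sum>k<N. u k i * cnj (u k j))"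
      using c by (simp add: scalar_prod_def mat_adjoint_index atLeast0LessThan) (simp add: U_def)
    then show "(U * mat_adjoint U) $$ (i, j) = 1\<^sub>m N $$ (i, j)"
      unfolding o(2)[OF ij] using ij by simp
  qed (use c in auto)
  moreover have "A = U * mat_diag N (\<lambda>i. complex_of_real (d i)) * mat_adjoint U"
  proof (rule eq_matI)
    fix l m assume "l < dim_row (U * mat_diag N (\<lambda>i. complex_of_real (d i)) * mat_adjoint U)"
      "m < dim_col (U * mat_diag N (\<lambda>i. complex_of_real (d i)) * mat_adjoint U)"
    then have "l < N" "m < N" using c by auto
    then show "A $$ (l, m) = (U * mat_diag N (\<lambda>i. complex_of_real (d i)) * mat_adjoint U) $$ (l, m)"
      using e unfolding unitary_conj_diag_index[OF U \<open>l < N\<close> \<open>m < N\<close>] by (simp add: U_def)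
  qed (use A c in auto)
  ultimately show ?thesis unfolding U_def[symmetric] diagonalizes_def unitary_def using c by auto
qed

lemma eigensystem_matfun:
  assumes "eigensystem N u d A"
  shows "eigensystem N u (\<lambda>j. f (d j)) (matfun f A)"
proof -
  define U where "U = mat N N (\<lambda>(l, j). u j l)"
  have U: "U \<in> carrier_mat N N" by (simp add: U_def)
  have "matfun f A = U * mat_diag N (\<lambda>i. complex_of_real (f (d i))) * mat_adjoint U"
    using matfun_eq[OF eigensystem_diagonalizes[OF assms]] by (simp add: U_def)
  moreover have "\<dots> \<in> carrier_mat N N"
    using U mat_adjoint_carrier[OF U] by auto
  ultimately show ?thesis
    using assms unitary_conj_diag_index[OF U] by (simp add: eigensystem_def U_def)
qed

lemma eigensystem_hermitian:
  assumes "eigensystem N u d A" shows "hermitian A"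
  using assms by (subst hermitian_iff[of A N]) (auto simp: eigensystem_def mult.commute)

lemma eigensystem_app:
  assumes "eigensystem N u d A" "j < N" "l < N"
  shows "app N A (u j) l = complex_of_real (d j) * u j l"
proof -
  have "app N A (u j) l = lin N (\<lambda>m. \<Sum>i<N. complex_of_real (d i) * (u i l * cnj (u i m))) (u j)"
    using assms by (intro lin_cong) (simp_all add: eigensystem_def)
  also have "\<dots> = (\<Sum>i<N. complex_of_real (d i) * u i l * ip N (u i) (u j))"
  proof -
    have "lin N (\<lambda>m. \<Sum>i<N. complex_of_real (d i) * (u i l * cnj (u i m))) (u j)
      = (\<Sum>m<N. \<Sum>i<N. complex_of_real (d i) * u i l * (cnj (u i m) * u j m))"
      by (simp add: lin_def sum_distrib_right mult.assoc)
    also have "\<dots> = (\<Sum>i<N. \<Sum>m<N. complex_of_real (d i) * u i l * (cnj (u i m) * u j m))"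
      by (rule sum.swap)
    finally show ?thesis by (simp add: lin_def sum_distrib_left)
  qed
  also have "\<dots> = (\<Sum>i<N. if i = j then complex_of_real (d j) * u j l else 0)"
    using assms by (intro sum.cong refl) (simp add: eigensystem_def orthonormal_basis_def)
  finally show ?thesis using assms(2) by simp
qed

lemma selfadjoint_inI:
  assumes e: "eigensystem N u d A" and d: "\<And>j. j < N \<Longrightarrow> d j \<in> S"
  shows "A \<in> selfadjoint_in N S"
proof -
  have A: "A \<in> carrier_mat N N" and ob: "orthonormal_basis N u" using e by (auto simp: eigensystem_def)
  have "k \<in> complex_of_real ` S" if "k \<in> spectrum A" for k
  proof -
    from that A obtain v where v: "v \<in> carrier_vec N" "v \<noteq> 0\<^sub>v N" "A *\<^sub>v v = k \<cdot>\<^sub>v v"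
      by (auto simp: spectrum_def eigenvalue_def eigenvector_def)
    define x where "x l = v $ l" for l
    have kx: "app N A x l = k * x l" if "l < N" for l
      using arg_cong[OF v(3), of "\<lambda>w. w $ l"] that v(1) A
      by (simp add: lin_def x_def scalar_prod_def atLeast0LessThan)
    obtain l where l: "l < N" "x l \<noteq> 0" using v(1,2) by (auto simp: x_def vec_eq_iff)
    have "\<exists>j<N. ip N (u j) x \<noteq> 0"
    proof (rule ccontr)
      assume "\<not> ?thesis"
      then have "ip N x x = 0" unfolding parseval[OF ob, of x x] by simp
      then show False using ip_self_eq_0 l by blast
    qed
    then obtain j where j: "j < N" "ip N (u j) x \<noteq> 0" by blast
    have herm: "\<And>l m. l < N \<Longrightarrow> m < N \<Longrightarrow> A $$ (m, l) = cnj (A $$ (l, m))"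
      using eigensystem_hermitian[OF e] hermitian_iff[OF A] by blast
    have "k * ip N (u j) x = ip N (u j) (app N A x)"
      by (simp add: lin_cong[OF refl kx] lin_scale)
    also have "\<dots> = ip N (app N A (u j)) x" by (rule ip_app[OF herm])
    also have "\<dots> = ip N (\<lambda>l. complex_of_real (d j) * u j l) x"
      by (rule lin_cong) (simp_all add: eigensystem_app[OF e j(1)])
    also have "\<dots> = complex_of_real (d j) * ip N (u j) x"
      unfolding ip_scale_left by simp
    finally have "k = complex_of_real (d j)" using j(2) by simp
    then show ?thesis using d j(1) by blast
  qed
  then show ?thesis using A eigensystem_hermitian[OF e] by (auto simp: selfadjoint_in_def)
qed

lemma selfadjoint_inE:
  assumes "A \<in> selfadjoint_in N S"
  obtains u d where "eigensystem N u d A" "\<And>j. j < N \<Longrightarrow> d j \<in> S"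
proof -
  have A: "A \<in> carrier_mat N N" "hermitian A" "spectrum A \<subseteq> complex_of_real ` S"
    using assms by (auto simp: selfadjoint_in_def)
  then obtain u d where e: "eigensystem N u d A" using hermitian_eigensystem by blast
  have "d j \<in> S" if j: "j < N" for j
  proof -
    define v where "v = vec N (u j)"
    have "ip N (u j) (u j) = 1" using e j by (simp add: eigensystem_def orthonormal_basis_def)
    then have "\<exists>l<N. u j l \<noteq> 0" by (auto simp: lin_def intro: ccontr)
    then have "v \<noteq> 0\<^sub>v N" by (auto simp: v_def vec_eq_iff)
    moreover have "A *\<^sub>v v = complex_of_real (d j) \<cdot>\<^sub>v v"
    proof (rule eq_vecI)
      fix l assume "l < dim_vec (complex_of_real (d j) \<cdot>\<^sub>v v)"
      then have l: "l < N" by (simp add: v_def)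
      have "(A *\<^sub>v v) $ l = app N A (u j) l"
        using l A(1) by (simp add: lin_def v_def scalar_prod_def atLeast0LessThan)
      also have "\<dots> = complex_of_real (d j) * u j l"
        by (rule eigensystem_app[OF e j l])
      finally show "(A *\<^sub>v v) $ l = (complex_of_real (d j) \<cdot>\<^sub>v v) $ l" using l by (simp add: v_def)
    qed (use A(1) in \<open>simp add: v_def\<close>)
    ultimately have "eigenvector A v (complex_of_real (d j))"
      using A(1) by (simp add: eigenvector_def v_def)
    then have "complex_of_real (d j) \<in> spectrum A"
      by (auto simp: spectrum_def eigenvalue_def)
    then show ?thesis using A(3) by auto
  qed
  then show ?thesis using e that by blast
qed

lemma loewner_le_iff:
  assumes A: "A \<in> carrier_mat N N" "hermitian A" and B: "B \<in> carrier_mat N N" "hermitian B"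
  shows "loewner_le A B \<longleftrightarrow> (\<forall>x. Re (sform N A x x) \<le> Re (sform N B x x))"
proof -
  have BA: "B - A \<in> carrier_mat N N" using A B by auto
  have hB: "\<And>l m. l < N \<Longrightarrow> m < N \<Longrightarrow> cnj (B $$ (l, m)) = B $$ (m, l)"
    and hA: "\<And>l m. l < N \<Longrightarrow> m < N \<Longrightarrow> cnj (A $$ (l, m)) = A $$ (m, l)"
    using hermitian_index[OF A] hermitian_index[OF B] by simp_all
  have herm: "hermitian (B - A)"
    using hA hB A(1) B(1) by (simp add: hermitian_iff[OF BA])
  have diff: "sform N (B - A) x x = sform N B x x - sform N A x x" for x
    using A(1) B(1) by (simp add: sform_def algebra_simps sum_subtractf)
  have real: "Im (sform N (B - A) x x) = 0" for x
  proof -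
    have "cnj (sform N (B - A) x x) = (\<Sum>l<N. \<Sum>m<N. cnj (x m) * (B - A) $$ (m, l) * x l)"
      unfolding sform_def cnj_sum
      using hA hB A(1) B(1) by (intro sum.cong refl) (simp add: mult_ac)
    also have "\<dots> = sform N (B - A) x x"
      unfolding sform_def by (rule sum.swap)
    finally show ?thesis by (simp add: complex_eq_iff)
  qed
  have psd: "((B - A) *\<^sub>v v) \<bullet>c v = sform N (B - A) (\<lambda>l. v $ l) (\<lambda>l. v $ l)" if "v \<in> carrier_vec N" for v
    using that BA
    by (simp add: sform_def scalar_prod_def atLeast0LessThan sum_distrib_left sum_distrib_right mult_ac del: index_minus_mat)
  have "loewner_le A B \<longleftrightarrow> (\<forall>v \<in> carrier_vec N. 0 \<le> sform N (B - A) (\<lambda>l. v $ l) (\<lambda>l. v $ l))"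
    using herm carrier_matD(1)[OF A(1)] by (simp add: loewner_le_def pos_semidef_def psd)
  also have "\<dots> \<longleftrightarrow> (\<forall>x. 0 \<le> sform N (B - A) x x)"
  proof (intro iffI allI ballI)
    fix x assume *: "\<forall>v \<in> carrier_vec N. 0 \<le> sform N (B - A) (\<lambda>l. v $ l) (\<lambda>l. v $ l)"
    have "sform N (B - A) x x = sform N (B - A) (\<lambda>l. vec N x $ l) (\<lambda>l. vec N x $ l)"
      unfolding sform_def by (intro sum.cong refl) simp
    then show "0 \<le> sform N (B - A) x x" using *[rule_format, of "vec N x"] by simp
  qed simp
  also have "\<dots> \<longleftrightarrow> (\<forall>x. Re (sform N A x x) \<le> Re (sform N B x x))"
    using real by (simp add: less_eq_complex_def diff)
  finally show ?thesis .
qed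

text \<open>A Rayleigh quotient is a convex combination of eigenvalues.\<close>

lemma rayleigh_in_convex:
  assumes e: "eigensystem N u d A" and S: "convex S" "\<And>j. j < N \<Longrightarrow> d j \<in> S" and x: "ip N x x = 1"
  shows "Re (sform N A x x) \<in> S"
proof -
  let ?w = "\<lambda>j. (cmod (ip N (u j) x))\<^sup>2"
  have sq: "cnj z * z = complex_of_real ((cmod z)\<^sup>2)" for z
    by (metis complex_norm_square mult.commute)
  have ob: "orthonormal_basis N u" using e by (simp add: eigensystem_def)
  have "complex_of_real (\<Sum>j<N. ?w j) = 1"
    using x unfolding parseval[OF ob, of x x] sq by simp
  then have "(\<Sum>j<N. ?w j) = 1" by (simp only: of_real_eq_1_iff)
  then have "(\<Sum>j<N. ?w j *\<^sub>R d j) \<in> S"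
    using S by (intro convex_sum) auto
  moreover have "sform N A x x = complex_of_real (\<Sum>j<N. ?w j *\<^sub>R d j)"
    unfolding sform_eigensystem[OF e] sq by (simp add: mult.commute)
  ultimately show ?thesis by simp
qed

lemma sform_eigenvector:
  assumes e: "eigensystem N u d A" and ij: "i < N" "j < N"
  shows "sform N A (u i) (u j) = (if i = j then complex_of_real (d i) else 0)"
proof -
  have "sform N A (u i) (u j) = (\<Sum>k<N. if k = i then (if i = j then complex_of_real (d i) else 0) else 0)"
    unfolding sform_eigensystem[OF e] using e ij
    by (intro sum.cong refl) (auto simp: eigensystem_def orthonormal_basis_def)
  then show ?thesis using ij by simp
qed

section \<open>Newton remainders and matrix convexity\<close>

lemma Re_real_form_nonneg:
  fixes M :: "nat \<Rightarrow> nat \<Rightarrow> real" and z :: "nat \<Rightarrow> complex"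
  assumes "\<And>x. 0 \<le> (\<Sum>k<N. \<Sum>l<N. x k * x l * M k l)"
  shows "0 \<le> Re (\<Sum>k<N. \<Sum>l<N. complex_of_real (M k l) * (z k * cnj (z l)))"
proof -
  have "Re (\<Sum>k<N. \<Sum>l<N. complex_of_real (M k l) * (z k * cnj (z l)))
      = (\<Sum>k<N. \<Sum>l<N. Re (z k) * Re (z l) * M k l) + (\<Sum>k<N. \<Sum>l<N. Im (z k) * Im (z l) * M k l)"
    unfolding Re_sum sum.distrib[symmetric] by (intro sum.cong refl) (simp add: algebra_simps)
  then show ?thesis using assms[of "\<lambda>k. Re (z k)"] assms[of "\<lambda>k. Im (z k)"] by simp
qed

text \<open>Taken in the eigenbasis \<open>w\<close> of \<open>C\<close>, the first-order remainder of the functional calculus at \<open>C\<close>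
  is a sum of Schur products of matrices of scalar Newton remainders, one for each eigenvalue \<open>a i\<close> of
  \<open>A\<close>, with positive rank one matrices. In the subtracted term \<open>D\<close> plays the role of the first
  divided difference of \<open>f\<close>, so that this term is the form of the derivative of the functional
  calculus at \<open>C\<close> in the direction \<open>A - C\<close>; the identity holds for any \<open>D\<close>.\<close>

lemma matfun_newton_remainder:
  fixes D :: "real \<Rightarrow> real \<Rightarrow> real" and y :: "nat \<Rightarrow> complex"
  assumes A: "eigensystem N u a A" and C: "eigensystem N w c C"
  defines "p \<equiv> \<lambda>k. ip N (w k) y"
  shows "sform N (matfun f A) y y - sform N (matfun f C) y y
      - (\<Sum>k<N. \<Sum>l<N. complex_of_real (D (c k) (c l)) * (cnj (p k) * p l)
          * (sform N A (w k) (w l) - sform N C (w k) (w l)))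
    = (\<Sum>i<N. \<Sum>k<N. \<Sum>l<N.
        complex_of_real (f (a i) - f (c k) - D (c k) (c l) * (a i - c k))
          * ((cnj (p k) * ip N (w k) (u i)) * cnj (cnj (p l) * ip N (w l) (u i))))"
proof -
  define G where "G k i = ip N (w k) (u i)" for k i
  define X where "X i k l = (cnj (p k) * G k i) * cnj (cnj (p l) * G l i)" for i k l
  have u: "orthonormal_basis N u" and w: "orthonormal_basis N w"
    using A C by (simp_all add: eigensystem_def)
  have G: "ip N (u i) (w k) = cnj (G k i)" for i k by (simp add: G_def cnj_ip)
  have delta: "(\<Sum>i<N. G k i * cnj (G l i)) = (if k = l then 1 else 0)" if "k < N" "l < N" for k l
  proof -
    have "(\<Sum>i<N. G k i * cnj (G l i)) = ip N (w k) (w l)"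
      unfolding parseval[OF u, of "w k" "w l"] G by simp
    then show ?thesis using w that by (simp add: orthonormal_basis_def)
  qed
  have sumX: "(\<Sum>i<N. X i k l) = (if k = l then cnj (p k) * p k else 0)" if "k < N" "l < N" for k l
  proof -
    have "(\<Sum>i<N. X i k l) = cnj (p k) * p l * (\<Sum>i<N. G k i * cnj (G l i))"
      unfolding sum_distrib_left by (rule sum.cong) (simp_all add: X_def mult_ac)
    then show ?thesis using delta[OF that] by simp
  qed
  have ua: "cnj (ip N (u i) y) * ip N (u i) y = (\<Sum>k<N. \<Sum>l<N. X i k l)" for i
  proof -
    have q: "ip N (u i) y = (\<Sum>k<N. cnj (G k i) * p k)"
      unfolding parseval[OF w, of "u i" y] by (simp add: G_def p_def)
    have "cnj (ip N (u i) y) = (\<Sum>k<N. cnj (p k) * G k i)"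
      unfolding q by (simp add: mult.commute)
    then have "cnj (ip N (u i) y) * ip N (u i) y = (\<Sum>k<N. cnj (p k) * G k i) * (\<Sum>l<N. cnj (G l i) * p l)"
      by (simp only: q)
    then show ?thesis
      by (simp only: sum_product) (simp add: X_def mult_ac)
  qed
  have fA: "sform N (matfun f A) y y = (\<Sum>i<N. \<Sum>k<N. \<Sum>l<N. complex_of_real (f (a i)) * X i k l)"
    unfolding sform_eigensystem[OF eigensystem_matfun[OF A]] ua by (simp add: sum_distrib_left)
  have swap3: "(\<Sum>i<N. \<Sum>k<N. \<Sum>l<N. F i k l) = (\<Sum>k<N. \<Sum>l<N. \<Sum>i<N. F i k l)"
    for F :: "nat \<Rightarrow> nat \<Rightarrow> nat \<Rightarrow> complex"
  proof -
    have "(\<Sum>i<N. \<Sum>k<N. \<Sum>l<N. F i k l) = (\<Sum>k<N. \<Sum>i<N. \<Sum>l<N. F i k l)"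
      by (rule sum.swap)
    also have "\<dots> = (\<Sum>k<N. \<Sum>l<N. \<Sum>i<N. F i k l)"
      by (intro sum.cong refl sum.swap)
    finally show ?thesis .
  qed
  have fC: "sform N (matfun f C) y y = (\<Sum>i<N. \<Sum>k<N. \<Sum>l<N. complex_of_real (f (c k)) * X i k l)"
  proof -
    have "(\<Sum>i<N. \<Sum>k<N. \<Sum>l<N. complex_of_real (f (c k)) * X i k l)
        = (\<Sum>k<N. \<Sum>l<N. complex_of_real (f (c k)) * (\<Sum>i<N. X i k l))"
      by (subst swap3) (simp only: sum_distrib_left)
    also have "\<dots> = (\<Sum>k<N. \<Sum>l<N. if l = k then complex_of_real (f (c k)) * (cnj (p k) * p k) else 0)"
      by (intro sum.cong refl) (simp add: sumX)
    also have "\<dots> = sform N (matfun f C) y y"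
      unfolding sform_eigensystem[OF eigensystem_matfun[OF C]] by (simp add: p_def)
    finally show ?thesis by simp
  qed
  have T: "(\<Sum>k<N. \<Sum>l<N. complex_of_real (D (c k) (c l)) * (cnj (p k) * p l)
          * (sform N A (w k) (w l) - sform N C (w k) (w l)))
      = (\<Sum>i<N. \<Sum>k<N. \<Sum>l<N. complex_of_real (D (c k) (c l) * (a i - c k)) * X i k l)"
  proof (subst swap3, intro sum.cong refl)
    fix k l assume kl: "k \<in> {..<N}" "l \<in> {..<N}"
    have "sform N A (w k) (w l) = (\<Sum>i<N. complex_of_real (a i) * (G k i * cnj (G l i)))"
      unfolding sform_eigensystem[OF A] G by simp
    moreover have "sform N C (w k) (w l) = (\<Sum>i<N. complex_of_real (c k) * (G k i * cnj (G l i)))"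
      using kl by (simp add: sform_eigenvector[OF C] sum_distrib_left[symmetric] delta)
    ultimately have "sform N A (w k) (w l) - sform N C (w k) (w l)
        = (\<Sum>i<N. complex_of_real (a i - c k) * (G k i * cnj (G l i)))"
      by (simp add: sum_subtractf left_diff_distrib)
    then show "complex_of_real (D (c k) (c l)) * (cnj (p k) * p l)
          * (sform N A (w k) (w l) - sform N C (w k) (w l))
        = (\<Sum>i<N. complex_of_real (D (c k) (c l) * (a i - c k)) * X i k l)"
      unfolding X_def by (simp add: sum_distrib_left mult_ac)
  qed
  show ?thesis
    unfolding fA fC T G_def[symmetric] X_def[symmetric]
    by (simp add: sum_subtractf left_diff_distrib)
qed

text \<open>At a convex combination \<open>C\<close> of \<open>A\<close> and \<open>B\<close> the first-order terms in the directions \<open>A - C\<close> and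
  \<open>B - C\<close> cancel, so nonnegative remainders give convexity.\<close>

theorem matrix_convexI:
  fixes D :: "real \<Rightarrow> real \<Rightarrow> real"
  assumes S: "convex S"
    and K: "\<And>s c x. s \<in> S \<Longrightarrow> (\<forall>k<N. c k \<in> S) \<Longrightarrow>
       0 \<le> (\<Sum>k<N. \<Sum>l<N. x k * x l * (f s - f (c k) - D (c k) (c l) * (s - c k)))"
  shows "matrix_convex N S f"
  unfolding matrix_convex_def
proof (intro ballI)
  fix t :: real and A B
  assume t: "t \<in> {0..1}" and AB: "A \<in> selfadjoint_in N S" "B \<in> selfadjoint_in N S"
  from AB(1) obtain u a where A: "eigensystem N u a A" and a: "\<And>j. j < N \<Longrightarrow> a j \<in> S"
    by (rule selfadjoint_inE) blast
  from AB(2) obtain v b where B: "eigensystem N v b B" and b: "\<And>j. j < N \<Longrightarrow> b j \<in> S"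
    by (rule selfadjoint_inE) blast
  have mix: "complex_of_real t \<cdot>\<^sub>m X + complex_of_real (1 - t) \<cdot>\<^sub>m Y \<in> carrier_mat N N"
      "hermitian (complex_of_real t \<cdot>\<^sub>m X + complex_of_real (1 - t) \<cdot>\<^sub>m Y)"
      "sform N (complex_of_real t \<cdot>\<^sub>m X + complex_of_real (1 - t) \<cdot>\<^sub>m Y) x y
        = complex_of_real t * sform N X x y + complex_of_real (1 - t) * sform N Y x y"
    if e: "eigensystem N u' d X" "eigensystem N v' d' Y" for u' v' d d' X Y x y
  proof -
    have X: "X \<in> carrier_mat N N" and Y: "Y \<in> carrier_mat N N" using e by (auto simp: eigensystem_def)
    then show c: "complex_of_real t \<cdot>\<^sub>m X + complex_of_real (1 - t) \<cdot>\<^sub>m Y \<in> carrier_mat N N" by simp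
    note * = hermitian_index[OF X eigensystem_hermitian[OF e(1)]]
      hermitian_index[OF Y eigensystem_hermitian[OF e(2)]]
    show "hermitian (complex_of_real t \<cdot>\<^sub>m X + complex_of_real (1 - t) \<cdot>\<^sub>m Y)"
      unfolding hermitian_iff[OF c] using X Y by (simp add: *)
    show "sform N (complex_of_real t \<cdot>\<^sub>m X + complex_of_real (1 - t) \<cdot>\<^sub>m Y) x y
        = complex_of_real t * sform N X x y + complex_of_real (1 - t) * sform N Y x y"
      using X Y unfolding sform_def sum_distrib_left sum.distrib[symmetric]
      by (intro sum.cong refl) (simp add: algebra_simps)
  qed
  define C where "C = complex_of_real t \<cdot>\<^sub>m A + complex_of_real (1 - t) \<cdot>\<^sub>m B"
  obtain w c where C: "eigensystem N w c C"
    using hermitian_eigensystem[OF mix(1,2)[OF A B]] unfolding C_def by blast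
  have cS: "c k \<in> S" if k: "k < N" for k
  proof -
    have w1: "ip N (w k) (w k) = 1" using C k by (simp add: eigensystem_def orthonormal_basis_def)
    have "complex_of_real (c k) = sform N C (w k) (w k)" using sform_eigenvector[OF C k k] by simp
    also have "\<dots> = complex_of_real t * sform N A (w k) (w k) + complex_of_real (1 - t) * sform N B (w k) (w k)"
      unfolding C_def by (rule mix(3)[OF A B])
    finally have "Re (complex_of_real (c k)) = Re (complex_of_real t * sform N A (w k) (w k)
        + complex_of_real (1 - t) * sform N B (w k) (w k))" by (rule arg_cong)
    then have "c k = t * Re (sform N A (w k) (w k)) + (1 - t) * Re (sform N B (w k) (w k))" by simp
    moreover have "Re (sform N A (w k) (w k)) \<in> S" "Re (sform N B (w k) (w k)) \<in> S"
      using rayleigh_in_convex[OF A S a w1] rayleigh_in_convex[OF B S b w1] by auto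
    ultimately show ?thesis using convexD[OF S, of _ _ t "1 - t"] t by simp
  qed
  define F where "F = complex_of_real t \<cdot>\<^sub>m matfun f A + complex_of_real (1 - t) \<cdot>\<^sub>m matfun f B"
  note fA = eigensystem_matfun[OF A, of f] and fB = eigensystem_matfun[OF B, of f]
    and fC = eigensystem_matfun[OF C, of f]
  have "Re (sform N (matfun f C) y y) \<le> Re (sform N F y y)" for y
  proof -
    define p where "p k = ip N (w k) y" for k
    define T where "T X = (\<Sum>k<N. \<Sum>l<N. complex_of_real (D (c k) (c l)) * (cnj (p k) * p l)
          * (sform N X (w k) (w l) - sform N C (w k) (w l)))" for X
    have rem: "Re (T X) \<le> Re (sform N (matfun f X) y y) - Re (sform N (matfun f C) y y)"
      if X: "eigensystem N u' d X" "\<And>j. j < N \<Longrightarrow> d j \<in> S" for u' d X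
    proof -
      have "0 \<le> Re (\<Sum>k<N. \<Sum>l<N.
        complex_of_real (f (d i) - f (c k) - D (c k) (c l) * (d i - c k))
          * ((cnj (p k) * ip N (w k) (u' i)) * cnj (cnj (p l) * ip N (w l) (u' i))))" if "i < N" for i
        by (rule Re_real_form_nonneg, rule K) (use X(2) cS that in auto)
      then have "0 \<le> (\<Sum>i<N. Re (\<Sum>k<N. \<Sum>l<N.
        complex_of_real (f (d i) - f (c k) - D (c k) (c l) * (d i - c k))
          * ((cnj (p k) * ip N (w k) (u' i)) * cnj (cnj (p l) * ip N (w l) (u' i)))))"
        by (intro sum_nonneg) blast
      also have "\<dots> = Re (sform N (matfun f X) y y - sform N (matfun f C) y y - T X)"
        unfolding T_def p_def matfun_newton_remainder[OF X(1) C] by (rule Re_sum[symmetric])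
      finally show ?thesis by simp
    qed
    have "complex_of_real t * T A + complex_of_real (1 - t) * T B = 0"
    proof -
      have "complex_of_real t * T A + complex_of_real (1 - t) * T B
        = (\<Sum>k<N. \<Sum>l<N. complex_of_real (D (c k) (c l)) * (cnj (p k) * p l)
          * (complex_of_real t * sform N A (w k) (w l) + complex_of_real (1 - t) * sform N B (w k) (w l)
             - sform N C (w k) (w l)))"
        unfolding T_def sum_distrib_left sum.distrib[symmetric]
        by (intro sum.cong refl) (simp add: algebra_simps)
      then show ?thesis unfolding mix(3)[OF A B, symmetric] C_def[symmetric] by simp
    qed
    then have "Re (complex_of_real t * T A + complex_of_real (1 - t) * T B) = 0" by (simp only: zero_complex.sel)
    then have T0: "t * Re (T A) + (1 - t) * Re (T B) = 0" by simp
    have "t * Re (T A) \<le> t * (Re (sform N (matfun f A) y y) - Re (sform N (matfun f C) y y))"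
      using rem[OF A a] t by (intro mult_left_mono) auto
    moreover have "(1 - t) * Re (T B) \<le> (1 - t) * (Re (sform N (matfun f B) y y) - Re (sform N (matfun f C) y y))"
      using rem[OF B b] t by (intro mult_left_mono) auto
    moreover have "Re (sform N F y y) = t * Re (sform N (matfun f A) y y) + (1 - t) * Re (sform N (matfun f B) y y)"
      unfolding F_def mix(3)[OF fA fB] by simp
    ultimately show ?thesis using T0 by (simp add: algebra_simps)
  qed
  then have "loewner_le (matfun f C) F"
    using loewner_le_iff[of "matfun f C" N F] mix(1,2)[OF fA fB] eigensystem_hermitian[OF fC] fC
    unfolding F_def[symmetric] by (simp add: eigensystem_def)
  then show "loewner_le (matfun f (complex_of_real t \<cdot>\<^sub>m A + complex_of_real (1 - t) \<cdot>\<^sub>m B))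
      (complex_of_real t \<cdot>\<^sub>m matfun f A + complex_of_real (1 - t) \<cdot>\<^sub>m matfun f B)"
    unfolding C_def F_def .
qed

section \<open>Positivity of the Loewner matrix of a matrix monotone function\<close>

text \<open>If the weights \<open>v n\<close> vanish in the limit wherever \<open>b n\<close> stays away from \<open>a\<close>, then \<open>h (b n)\<close> may
  be replaced by \<open>h a\<close> in the limit. This takes the place of convergence of eigenvectors.\<close>

lemma weighted_continuity:
  fixes h :: "real \<Rightarrow> real" and v :: "nat \<Rightarrow> complex"
  assumes S: "compact S" "continuous_on S h" "\<And>n. b n \<in> S" "a \<in> S"
    and v: "\<And>n. cmod (v n) \<le> 1" and lim: "(\<lambda>n. complex_of_real (b n - a) * v n) \<longlonglongrightarrow> 0"
  shows "(\<lambda>n. complex_of_real (h (b n) - h a) * v n) \<longlonglongrightarrow> 0"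
proof (rule LIMSEQ_I)
  fix e :: real assume e: "0 < e"
  obtain d where d: "d > 0" "\<And>x. x \<in> S \<Longrightarrow> dist x a < d \<Longrightarrow> dist (h x) (h a) < e / 2"
    using S(2,4) e unfolding continuous_on_iff by (meson half_gt_zero)
  obtain M where M: "M > 0" "\<And>x. x \<in> S \<Longrightarrow> \<bar>h x\<bar> \<le> M"
    using compact_imp_bounded[OF compact_continuous_image[OF S(2,1)]] unfolding bounded_pos by auto
  have "e * d / (4 * M) > 0" using e d M by simp
  from LIMSEQ_D[OF lim this] obtain n0 where
    n0: "\<And>n. n \<ge> n0 \<Longrightarrow> cmod (complex_of_real (b n - a) * v n) < e * d / (4 * M)" by auto
  have "cmod (complex_of_real (h (b n) - h a) * v n) < e" if n: "n \<ge> n0" for n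
  proof (cases "\<bar>b n - a\<bar> < d")
    case True
    then have "\<bar>h (b n) - h a\<bar> < e / 2" using d(2)[OF S(3)[of n]] by (simp add: dist_real_def)
    then have "\<bar>h (b n) - h a\<bar> * cmod (v n) \<le> e / 2 * 1"
      using v[of n] e by (intro mult_mono) auto
    then show ?thesis using e by (simp add: norm_mult del: of_real_diff)
  next
    case False
    have "d * cmod (v n) \<le> \<bar>b n - a\<bar> * cmod (v n)" using False by (intro mult_right_mono) auto
    also have "\<dots> < e * d / (4 * M)" using n0[OF n] by (simp add: norm_mult del: of_real_diff)
    finally have "2 * M * cmod (v n) < e / 2"
      using d M by (simp add: field_simps)
    moreover have "\<bar>h (b n) - h a\<bar> * cmod (v n) \<le> 2 * M * cmod (v n)"
      using M(2)[OF S(3)[of n]] M(2)[OF S(4)] by (intro mult_right_mono) auto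
    ultimately show ?thesis using e by (simp add: norm_mult del: of_real_diff)
  qed
  then show "\<exists>n0. \<forall>n\<ge>n0. norm (complex_of_real (h (b n) - h a) * v n - 0) < e" by auto
qed

text \<open>Loewner's necessary condition. The diagonal matrix \<open>A\<close> of the given points is compared with
  \<open>A + t J\<close>, where \<open>J\<close> is the all-ones matrix; the increment of the functional calculus, divided
  by \<open>t\<close>, tends to the Loewner matrix as \<open>t\<close> tends to \<open>0\<close>.\<close>

theorem matrix_monotone_imp_loewner_nonneg:
  fixes g g' :: "real \<Rightarrow> real" and lam y :: "nat \<Rightarrow> real"
  assumes mono: "matrix_monotone N {a<..<b} g"
    and deriv: "\<And>t. t \<in> {a<..<b} \<Longrightarrow> (g has_real_derivative g' t) (at t)"
    and lam: "\<And>k. k < N \<Longrightarrow> lam k \<in> {a<..<b}"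
  defines "L \<equiv> \<lambda>s t. if s = t then g' t else (g s - g t) / (s - t)"
  shows "0 \<le> (\<Sum>k<N. \<Sum>l<N. y k * y l * L (lam k) (lam l))"
proof (cases "N = 0")
  case False
  define m M where "m = Min (lam ` {..<N})" and "M = Max (lam ` {..<N})"
  have mM: "m \<le> lam k" "lam k \<le> M" if "k < N" for k
    using that by (auto simp: m_def M_def)
  have "m \<in> lam ` {..<N}" "M \<in> lam ` {..<N}"
    unfolding m_def M_def using False by (auto intro!: Min_in Max_in)
  then have am: "a < m" "M < b" "m \<le> M" using lam mM by auto
  define S where "S = {m..(M + b) / 2}"
  have S: "compact S" "S \<subseteq> {a<..<b}" "\<And>k. k < N \<Longrightarrow> lam k \<in> S"
    using am mM by (force simp: S_def)+
  \<comment> \<open>\<open>N\<^sup>2\<close> bounds \<open>\<langle>v, J v\<rangle>\<close> for the unit eigenvectors \<open>v\<close>, so the spectra of all perturbed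
    matrices stay in \<open>S\<close>\<close>
  define t where "t n = (b - M) / (2 * (real N)\<^sup>2) / real (Suc n)" for n
  have t: "t n > 0" "t n * (real N)\<^sup>2 \<le> (b - M) / 2" for n
  proof -
    show "t n > 0" using am False by (simp add: t_def)
    have "t n * (real N)\<^sup>2 = (b - M) / 2 / real (Suc n)" using False by (simp add: t_def)
    also have "\<dots> \<le> (b - M) / 2 / 1" using am by (intro divide_left_mono) auto
    finally show "t n * (real N)\<^sup>2 \<le> (b - M) / 2" by simp
  qed
  have t0: "t \<longlonglongrightarrow> 0"
    unfolding t_def by (rule LIMSEQ_Suc[OF lim_const_over_n])
  define A where "A = mat N N (\<lambda>(l, r). if l = r then complex_of_real (lam l) else 0)"
  define B where "B n = mat N N (\<lambda>(l, r). (if l = r then complex_of_real (lam l) else 0) + complex_of_real (t n))" for n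
  have delta: "(\<Sum>l<N. F l * (if l = i then 1 else 0)) = F i" "(\<Sum>l<N. F l * (if i = l then 1 else 0)) = F i"
    if "i < N" for i and F :: "nat \<Rightarrow> complex"
  proof -
    have "(\<Sum>l<N. F l * (if l = i then 1 else 0)) = (\<Sum>l<N. if l = i then F i else 0)"
      by (intro sum.cong refl) simp
    then show 1: "(\<Sum>l<N. F l * (if l = i then 1 else 0)) = F i" using that by simp
    show "(\<Sum>l<N. F l * (if i = l then 1 else 0)) = F i" unfolding eq_commute[of i] by (rule 1)
  qed
  have diag: "(\<Sum>k<N. complex_of_real (e k) * ((if i = k then 1 else 0) * cnj (if j = k then 1 else 0)))
      = (if i = j then complex_of_real (e i) else 0)" if "i < N" "j < N" for e i j
    using delta(2)[OF \<open>j < N\<close>, of "\<lambda>k. complex_of_real (e k) * (if i = k then 1 else 0)"] that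
    by (auto simp: if_distrib[of cnj] mult.assoc cong: if_cong)
  have eA: "eigensystem N (\<lambda>j l. if l = j then 1 else 0) lam A"
    unfolding eigensystem_def orthonormal_basis_def lin_def
  proof (intro conjI allI impI)
    fix i j assume "i < N" "j < N"
    then show "(\<Sum>l<N. cnj (if l = i then 1 else 0) * (if l = j then 1 else 0)) = (if i = j then 1 else 0)"
      by (simp add: delta(1))
    show "(\<Sum>k<N. (if i = k then 1 else 0) * cnj (if j = k then 1 else 0)) = (if i = j then 1 else 0 :: complex)"
      using delta(2)[OF \<open>j < N\<close>, of "\<lambda>k. if i = k then 1 else 0"] by (simp add: if_distrib[of cnj] cong: if_cong)
    show "A $$ (i, j) = (\<Sum>k<N. complex_of_real (lam k) * ((if i = k then 1 else 0) * cnj (if j = k then 1 else 0)))"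
      unfolding diag[OF \<open>i < N\<close> \<open>j < N\<close>] using \<open>i < N\<close> \<open>j < N\<close> by (simp add: A_def)
  qed (simp add: A_def)
  have Bc: "B n \<in> carrier_mat N N" for n by (simp add: B_def)
  have Bh: "hermitian (B n)" for n
    by (subst hermitian_iff[OF Bc]) (auto simp: B_def)
  have "\<exists>v c. eigensystem N v c (B n)" for n by (rule hermitian_eigensystem[OF Bc Bh])
  then obtain v c where eB: "\<And>n. eigensystem N (v n) (c n) (B n)" by metis
  define s where "s n j = (\<Sum>r<N. v n j r)" for n j
  have sB: "sform N (B n) x x = sform N A x x + complex_of_real (t n * (cmod (\<Sum>r<N. x r))\<^sup>2)" for n x
  proof -
    have "sform N (B n) x x = sform N A x x + complex_of_real (t n) * (\<Sum>l<N. \<Sum>r<N. cnj (x l) * x r)"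
      unfolding sform_def sum_distrib_left sum.distrib[symmetric]
      by (intro sum.cong refl) (simp add: A_def B_def algebra_simps)
    also have "(\<Sum>l<N. \<Sum>r<N. cnj (x l) * x r) = cnj (\<Sum>r<N. x r) * (\<Sum>r<N. x r)"
      by (simp only: cnj_sum sum_product)
    also have "\<dots> = complex_of_real ((cmod (\<Sum>r<N. x r))\<^sup>2)"
      by (metis complex_norm_square mult.commute)
    finally show ?thesis by simp
  qed
  have v1: "ip N (v n j) (v n j) = 1" if "j < N" for n j
    using eB[of n] that by (simp add: eigensystem_def orthonormal_basis_def)
  have v_le: "cmod (v n j l) \<le> 1" if "j < N" "l < N" for n j l
  proof -
    have "complex_of_real (\<Sum>l<N. (cmod (v n j l))\<^sup>2) = 1" using v1[OF that(1), of n] unfolding ip_self .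
    then have "(\<Sum>l<N. (cmod (v n j l))\<^sup>2) = 1" by (simp only: of_real_eq_1_iff)
    moreover have "(cmod (v n j l))\<^sup>2 \<le> (\<Sum>l<N. (cmod (v n j l))\<^sup>2)"
      using that by (intro member_le_sum) auto
    ultimately show ?thesis using power2_le_imp_le[of "cmod (v n j l)" 1] by simp
  qed
  have s_le: "cmod (s n j) \<le> real N" if "j < N" for n j
  proof -
    have "cmod (s n j) \<le> (\<Sum>r<N. cmod (v n j r))" unfolding s_def by (rule norm_sum)
    also have "\<dots> \<le> (\<Sum>r<N. 1)" by (intro sum_mono) (use v_le[OF that] in auto)
    finally show ?thesis by simp
  qed
  have cS: "c n j \<in> S" if j: "j < N" for n j
  proof -
    have "complex_of_real (c n j) = sform N A (v n j) (v n j) + complex_of_real (t n * (cmod (s n j))\<^sup>2)"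
      using sform_eigenvector[OF eB j j] unfolding sB s_def by simp
    then have eq: "c n j = Re (sform N A (v n j) (v n j)) + t n * (cmod (s n j))\<^sup>2"
      by (metis Re_complex_of_real plus_complex.sel(1))
    have "Re (sform N A (v n j) (v n j)) \<in> {m..M}"
      by (rule rayleigh_in_convex[OF eA _ _ v1[OF j]]) (use mM in auto)
    moreover have "0 \<le> t n * (cmod (s n j))\<^sup>2" using t(1)[of n] by simp
    moreover have "t n * (cmod (s n j))\<^sup>2 \<le> t n * (real N)\<^sup>2"
      using t(1)[of n] s_le[OF j] by (intro mult_left_mono power_mono) auto
    ultimately show ?thesis using t(2)[of n] eq by (auto simp: S_def field_simps)
  qed
  have eigen: "complex_of_real (c n j - lam l) * v n j l = complex_of_real (t n) * s n j"
    if "j < N" "l < N" for n j l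
  proof -
    have "complex_of_real (c n j) * v n j l = app N (B n) (v n j) l"
      using eigensystem_app[OF eB that] by simp
    also have "\<dots> = (\<Sum>r<N. (if r = l then complex_of_real (lam l) * v n j l else 0) + complex_of_real (t n) * v n j r)"
      unfolding lin_def using that by (intro sum.cong refl) (auto simp: B_def algebra_simps)
    also have "\<dots> = complex_of_real (lam l) * v n j l + complex_of_real (t n) * s n j"
      using that by (simp add: sum.distrib s_def sum_distrib_left)
    finally show ?thesis by (simp add: algebra_simps)
  qed
  \<comment> \<open>\<open>t n * P n l r\<close> is the entry \<open>(l, r)\<close> of \<open>g (B n) - g A\<close>\<close>
  define P where "P n l r = (\<Sum>j<N. complex_of_real (L (c n j) (lam l)) * (s n j * cnj (v n j r)))" for n l r
  have pos: "0 \<le> Re (\<Sum>l<N. \<Sum>r<N. complex_of_real (y l * y r) * P n l r)" for n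
  proof -
    let ?z = "\<lambda>l. complex_of_real (y l)"
    have fA: "eigensystem N (\<lambda>j l. if l = j then 1 else 0) (\<lambda>j. g (lam j)) (matfun g A)"
      by (rule eigensystem_matfun[OF eA])
    have fB: "eigensystem N (v n) (\<lambda>j. g (c n j)) (matfun g (B n))"
      by (rule eigensystem_matfun[OF eB])
    have "loewner_le A (B n)"
      using loewner_le_iff[of A N "B n"] Bc Bh eigensystem_hermitian[OF eA] t(1)[of n] sB
      by (simp add: A_def less_imp_le)
    moreover have "A \<in> selfadjoint_in N {a<..<b}" by (rule selfadjoint_inI[OF eA lam])
    moreover have "B n \<in> selfadjoint_in N {a<..<b}" by (rule selfadjoint_inI[OF eB]) (use cS S in blast)
    ultimately have "loewner_le (matfun g A) (matfun g (B n))"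
      using mono unfolding matrix_monotone_def by blast
    then have "0 \<le> Re (sform N (matfun g (B n)) ?z ?z - sform N (matfun g A) ?z ?z)"
      using loewner_le_iff[of "matfun g A" N "matfun g (B n)"] fA fB eigensystem_hermitian[OF fA]
        eigensystem_hermitian[OF fB] by (simp add: eigensystem_def)
    also have "sform N (matfun g (B n)) ?z ?z - sform N (matfun g A) ?z ?z
        = (\<Sum>l<N. \<Sum>r<N. complex_of_real (y l * y r) * (complex_of_real (t n) * P n l r))"
      unfolding sform_def sum_subtractf[symmetric]
    proof (intro sum.cong refl)
      fix l r assume "l \<in> {..<N}" "r \<in> {..<N}"
      then have lr: "l < N" "r < N" by auto
      have "matfun g A $$ (l, r) = (if l = r then complex_of_real (g (lam l)) else 0)"
        unfolding eigensystem_entry[OF fA lr] by (rule diag[OF lr])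
      also have "\<dots> = complex_of_real (g (lam l)) * (\<Sum>j<N. v n j l * cnj (v n j r))"
        using eB[of n] lr by (simp add: eigensystem_def orthonormal_basis_def)
      finally have gA: "matfun g A $$ (l, r) = (\<Sum>j<N. complex_of_real (g (lam l)) * (v n j l * cnj (v n j r)))"
        by (simp add: sum_distrib_left)
      have gB: "matfun g (B n) $$ (l, r) = (\<Sum>j<N. complex_of_real (g (c n j)) * (v n j l * cnj (v n j r)))"
        by (rule eigensystem_entry[OF fB lr])
      have "matfun g (B n) $$ (l, r) - matfun g A $$ (l, r)
          = (\<Sum>j<N. complex_of_real (t n) * (complex_of_real (L (c n j) (lam l)) * (s n j * cnj (v n j r))))"
        unfolding gA gB sum_subtractf[symmetric]
      proof (intro sum.cong refl)
        fix j assume "j \<in> {..<N}"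
        then have j: "j < N" by simp
        have "g (c n j) - g (lam l) = L (c n j) (lam l) * (c n j - lam l)" by (simp add: L_def)
        then have "complex_of_real (g (c n j)) * (v n j l * cnj (v n j r)) - complex_of_real (g (lam l)) * (v n j l * cnj (v n j r))
          = complex_of_real (L (c n j) (lam l)) * (complex_of_real (c n j - lam l) * v n j l) * cnj (v n j r)"
        proof -
          assume "g (c n j) - g (lam l) = L (c n j) (lam l) * (c n j - lam l)"
          from arg_cong[OF this, of complex_of_real]
          have "complex_of_real (g (c n j)) - complex_of_real (g (lam l))
              = complex_of_real (L (c n j) (lam l)) * complex_of_real (c n j - lam l)"
            by (simp only: of_real_diff of_real_mult)
          then show ?thesis by (simp only: left_diff_distrib[symmetric] mult.assoc)
        qed
        then show "complex_of_real (g (c n j)) * (v n j l * cnj (v n j r)) - complex_of_real (g (lam l)) * (v n j l * cnj (v n j r))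
          = complex_of_real (t n) * (complex_of_real (L (c n j) (lam l)) * (s n j * cnj (v n j r)))"
          unfolding eigen[OF j lr(1)] by (simp add: mult_ac)
      qed
      then have "matfun g (B n) $$ (l, r) - matfun g A $$ (l, r) = complex_of_real (t n) * P n l r"
        by (simp add: P_def sum_distrib_left)
      moreover have "cnj (?z l) * matfun g (B n) $$ (l, r) * ?z r - cnj (?z l) * matfun g A $$ (l, r) * ?z r
          = complex_of_real (y l * y r) * (matfun g (B n) $$ (l, r) - matfun g A $$ (l, r))"
        by (simp add: algebra_simps)
      ultimately show "cnj (?z l) * matfun g (B n) $$ (l, r) * ?z r - cnj (?z l) * matfun g A $$ (l, r) * ?z r
          = complex_of_real (y l * y r) * (complex_of_real (t n) * P n l r)" by simp
    qed
    also have "\<dots> = complex_of_real (t n) * (\<Sum>l<N. \<Sum>r<N. complex_of_real (y l * y r) * P n l r)"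
      by (simp add: sum_distrib_left mult_ac)
    finally have "0 \<le> t n * Re (\<Sum>l<N. \<Sum>r<N. complex_of_real (y l * y r) * P n l r)"
      by (simp only: Re_complex_of_real times_complex.sel Im_complex_of_real mult_zero_left diff_zero)
    then show ?thesis using t(1)[of n] by (simp add: zero_le_mult_iff del: Re_sum)
  qed
  have P_lim: "(\<lambda>n. P n l r) \<longlonglongrightarrow> complex_of_real (L (lam r) (lam l))" if lr: "l < N" "r < N" for l r
  proof -
    have g_cont: "continuous_on {a<..<b} g"
      using deriv by (intro DERIV_continuous_on) (auto intro: has_field_derivative_at_within)
    have "continuous_on {a<..<b} (\<lambda>x. L x (lam l))"
      unfolding L_def
      using difference_quotient_continuous_on[OF g_cont has_field_derivative_at_within[OF deriv[OF lam[OF lr(1)]]]]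
      by simp
    then have L_cont: "continuous_on S (\<lambda>x. L x (lam l))" by (rule continuous_on_subset[OF _ S(2)])
    have "(\<lambda>n. complex_of_real (L (c n j) (lam l) - L (lam q) (lam l)) * (v n j q * cnj (v n j r))) \<longlonglongrightarrow> 0"
      if "j < N" "q < N" for j q
    proof (rule weighted_continuity[OF S(1) L_cont])
      show "cmod (v n j q * cnj (v n j r)) \<le> 1" for n
        using v_le[OF that, of n] v_le[OF that(1) lr(2), of n] by (simp add: norm_mult mult_le_one)
      show "(\<lambda>n. complex_of_real (c n j - lam q) * (v n j q * cnj (v n j r))) \<longlonglongrightarrow> 0"
      proof (rule Lim_null_comparison)
        have "norm (complex_of_real (c n j - lam q) * (v n j q * cnj (v n j r))) \<le> t n * real N" for n
        proof -
          have "complex_of_real (c n j - lam q) * (v n j q * cnj (v n j r))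
              = complex_of_real (t n) * s n j * cnj (v n j r)"
            by (simp only: eigen[OF that, symmetric] mult.assoc)
          then have "norm (complex_of_real (c n j - lam q) * (v n j q * cnj (v n j r)))
              = norm (complex_of_real (t n) * s n j * cnj (v n j r))" by (rule arg_cong)
          also have "\<dots> = t n * (cmod (s n j) * cmod (v n j r))"
            using t(1)[of n] by (simp add: norm_mult)
          also have "\<dots> \<le> t n * (real N * 1)"
            using t(1)[of n] s_le[OF that(1), of n] v_le[OF that(1) lr(2), of n]
            by (intro mult_left_mono mult_mono) auto
          finally show ?thesis by simp
        qed
        then show "\<forall>\<^sub>F n in sequentially. norm (complex_of_real (c n j - lam q) * (v n j q * cnj (v n j r))) \<le> t n * real N"
          by simp
        show "(\<lambda>n. t n * real N) \<longlonglongrightarrow> 0" using tendsto_mult_left_zero[OF t0] by simp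
      qed
    qed (use cS S that in auto)
    then have "(\<lambda>n. \<Sum>q<N. \<Sum>j<N. complex_of_real (L (c n j) (lam l) - L (lam q) (lam l)) * (v n j q * cnj (v n j r))) \<longlonglongrightarrow> 0"
      by (intro tendsto_null_sum) auto
    moreover have "(\<Sum>q<N. \<Sum>j<N. complex_of_real (L (c n j) (lam l) - L (lam q) (lam l)) * (v n j q * cnj (v n j r)))
        = P n l r - complex_of_real (L (lam r) (lam l))" for n
    proof -
      have "(\<Sum>q<N. \<Sum>j<N. complex_of_real (L (c n j) (lam l) - L (lam q) (lam l)) * (v n j q * cnj (v n j r)))
        = (\<Sum>q<N. \<Sum>j<N. complex_of_real (L (c n j) (lam l)) * (v n j q * cnj (v n j r)))
          - (\<Sum>q<N. complex_of_real (L (lam q) (lam l)) * (\<Sum>j<N. v n j q * cnj (v n j r)))"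
        by (simp add: sum_distrib_left sum_subtractf left_diff_distrib)
      also have "(\<Sum>q<N. complex_of_real (L (lam q) (lam l)) * (\<Sum>j<N. v n j q * cnj (v n j r)))
          = (\<Sum>q<N. if q = r then complex_of_real (L (lam r) (lam l)) else 0)"
        using eB[of n] lr by (intro sum.cong refl) (simp add: eigensystem_def orthonormal_basis_def)
      also have "\<dots> = complex_of_real (L (lam r) (lam l))" using lr by simp
      also have "(\<Sum>q<N. \<Sum>j<N. complex_of_real (L (c n j) (lam l)) * (v n j q * cnj (v n j r))) = P n l r"
        by (subst sum.swap) (simp add: P_def s_def sum_distrib_left sum_distrib_right)
      finally show ?thesis .
    qed
    ultimately show ?thesis by (simp add: LIM_zero_iff)
  qed
  have "(\<lambda>n. Re (\<Sum>l<N. \<Sum>r<N. complex_of_real (y l * y r) * P n l r))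
      \<longlonglongrightarrow> Re (\<Sum>l<N. \<Sum>r<N. complex_of_real (y l * y r) * complex_of_real (L (lam r) (lam l)))"
    by (intro tendsto_Re tendsto_sum tendsto_mult tendsto_const P_lim) auto
  then have "0 \<le> Re (\<Sum>l<N. \<Sum>r<N. complex_of_real (y l * y r) * complex_of_real (L (lam r) (lam l)))"
    by (rule tendsto_lowerbound) (use pos in auto)
  also have "\<dots> = (\<Sum>l<N. \<Sum>r<N. y l * y r * L (lam r) (lam l))" by simp
  also have "\<dots> = (\<Sum>k<N. \<Sum>l<N. y k * y l * L (lam k) (lam l))"
    by (subst sum.swap) (simp add: mult.commute)
  finally show ?thesis .
qed simp

section \<open>Matrix convexity from a matrix monotone difference quotient\<close>

lemma Q_class_quadratic_form_nonneg:
  assumes Q: "f \<in> Q_class (Suc N) I" and c: "\<forall>k<N. c k \<in> I" and u: "u \<in> I"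
  shows "0 \<le> (\<Sum>k<N. \<Sum>l<N. z k * z l *
    (div_diff I f (c k) (c l) - div_diff I f (c k) u - div_diff I f u (c l) + div_diff I f u u))"
proof -
  define p where "p k = (if k < N then c k else u)" for k
  define y where "y k = (if k < N then z k else - (\<Sum>j<N. z j))" for k
  let ?D = "\<lambda>k l. div_diff I f (p k) (p l)"
  have ap: "almost_positive (loewner_matrix (Suc N) I f p)"
    using Q c u by (auto simp: Q_class_def p_def)
  define x where "x = vec (Suc N) (\<lambda>k. complex_of_real (y k))"
  have sy: "(\<Sum>k<Suc N. y k) = 0" by (simp add: y_def)
  have "(\<Sum>i<Suc N. x $ i) = complex_of_real (\<Sum>i<Suc N. y i)"
    unfolding of_real_sum x_def by (intro sum.cong refl) simp
  then have sx: "(\<Sum>i<Suc N. x $ i) = 0" unfolding sy by simp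
  have dim: "dim_row (loewner_matrix (Suc N) I f p) = Suc N" by (simp add: loewner_matrix_def)
  have "x \<in> carrier_vec (Suc N)" by (simp add: x_def)
  then have "0 \<le> (\<Sum>i<Suc N. \<Sum>j<Suc N. loewner_matrix (Suc N) I f p $$ (i, j) * x $ j * cnj (x $ i))"
    using ap sx unfolding almost_positive_def dim by blast
  also have "\<dots> = complex_of_real (\<Sum>i<Suc N. \<Sum>j<Suc N. y i * y j * ?D i j)"
    unfolding of_real_sum by (intro sum.cong refl) (simp add: loewner_matrix_def x_def mult_ac)
  finally have "0 \<le> (\<Sum>i<Suc N. \<Sum>j<Suc N. y i * y j * ?D i j)"
    by (simp only: less_eq_complex_def Re_complex_of_real zero_complex.sel)
  also have "\<dots> = (\<Sum>k<N. \<Sum>l<N. y k * y l * ?D k l) + (\<Sum>k<N. y k * y N * ?D k N)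
      + (\<Sum>l<N. y N * y l * ?D N l) + y N * y N * ?D N N"
    by (simp add: sum.distrib)
  also have "(\<Sum>k<N. \<Sum>l<N. y k * y l * ?D k l) = (\<Sum>k<N. \<Sum>l<N. z k * z l * div_diff I f (c k) (c l))"
    by (intro sum.cong refl) (simp add: y_def p_def)
  also have "(\<Sum>k<N. y k * y N * ?D k N) = - (\<Sum>k<N. \<Sum>l<N. z k * z l * div_diff I f (c k) u)"
    by (simp add: y_def p_def sum_negf[symmetric] sum_distrib_left sum_distrib_right mult_ac)
  also have "(\<Sum>l<N. y N * y l * ?D N l) = - (\<Sum>k<N. \<Sum>l<N. z k * z l * div_diff I f u (c l))"
    by (subst sum.swap) (simp add: y_def p_def sum_negf[symmetric] sum_distrib_left sum_distrib_right mult_ac)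
  also have "y N * y N * ?D N N = (\<Sum>k<N. \<Sum>l<N. z k * z l * div_diff I f u u)"
    by (simp add: y_def p_def sum_product sum_distrib_left sum_distrib_right mult_ac)
  finally show ?thesis
    by (simp add: sum.distrib sum_subtractf algebra_simps)
qed

theorem matrix_convex_of_monotone_quotient:
  fixes \<alpha> :: real and n :: nat and f :: "real \<Rightarrow> real"
  assumes "n \<ge> 2" and Q: "f \<in> Q_class n {0..<\<alpha>}"
    and mono: "matrix_monotone (n - 1) {0<..<\<alpha>} (\<lambda>t. (f t - f 0) / t)"
  shows "matrix_convex (n - 1) {0..<\<alpha>} f"
proof -
  define N where "N = n - 1"
  have n: "n = Suc N" "0 < N" using assms(1) by (auto simp: N_def)
  interpret C1_fun \<alpha> f by standard (use Q in \<open>simp add: Q_class_def\<close>)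
  interpret Q_fun \<alpha> f N
  proof
    fix c :: "nat \<Rightarrow> real" and u :: real and z :: "nat \<Rightarrow> real"
    assume "\<forall>k<N. c k \<in> I" "u \<in> I"
    from Q_class_quadratic_form_nonneg[OF Q[unfolded n(1)] this, of z]
    show "0 \<le> (\<Sum>k<N. \<Sum>l<N. z k * z l * (D (c k) (c l) - D (c k) u - D u (c l) + f' u))"
      unfolding D_same .
  qed (fact n(2))
  define g where "g t = (f t - f 0) / t" for t
  have gd: "(g has_real_derivative D3 0 t t) (at t)" if "t \<in> {0<..<\<alpha>}" for t
  proof -
    have "(g has_real_derivative (f' t * t - (f t - f 0) * 1) / (t * t)) (at t)"
      unfolding g_def using that
      by (intro DERIV_divide) (auto intro!: derivative_eq_intros has_deriv_interior)
    then show ?thesis using that by (simp add: D3_def nrem_def D_same algebra_simps)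
  qed
  \<comment> \<open>the Loewner matrix of \<open>g\<close> has the entries \<open>[0, s, t]\<close>\<close>
  have gq: "(if s = t then D3 0 t t else (g s - g t) / (s - t)) = D3 0 s t" if "0 < s" "0 < t" for s t
  proof (cases "s = t")
    case False
    have "f s = f 0 + s * g s" "f t = f 0 + t * g t" using that by (simp_all add: g_def)
    then have "D s t = (s * g s - t * g t) / (s - t)" "D 0 s = g s"
      using False that by (simp_all add: div_diff_def)
    then have "D3 0 s t = (g s - (s * g s - t * g t) / (s - t)) / (0 - t)"
      using that by (simp add: D3_eq)
    also have "\<dots> = (g s - g t) / (s - t)" using False that by (simp add: field_simps)
    finally show ?thesis using False by simp
  qed simp
  have L: "0 \<le> (\<Sum>k<N. \<Sum>l<N. z k * z l * D3 0 (c k) (c l))"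
    if c: "\<forall>k<N. 0 < c k \<and> c k < \<alpha>" for c z :: "nat \<Rightarrow> real"
  proof -
    have "0 \<le> (\<Sum>k<N. \<Sum>l<N. z k * z l
        * (if c k = c l then D3 0 (c l) (c l) else (g (c k) - g (c l)) / (c k - c l)))"
      using mono matrix_monotone_imp_loewner_nonneg[of N 0 \<alpha> g "\<lambda>t. D3 0 t t" c z] gd c
      by (simp add: N_def g_def[abs_def])
    also have "\<dots> = (\<Sum>k<N. \<Sum>l<N. z k * z l * D3 0 (c k) (c l))"
      using c gq by (intro sum.cong refl) simp
    finally show ?thesis .
  qed
  have "matrix_convex N I f"
  proof (rule matrix_convexI)
    fix s :: real and c x :: "nat \<Rightarrow> real"
    assume "s \<in> I" "\<forall>k<N. c k \<in> I"
    from nrem_nonneg[OF L this, of x]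
    show "0 \<le> (\<Sum>k<N. \<Sum>l<N. x k * x l * (f s - f (c k) - D (c k) (c l) * (s - c k)))"
      unfolding nrem_def .
  qed simp
  then show ?thesis by (simp add: N_def)
qed

theorem theorem5p10:
  fixes \<alpha> :: real and n :: nat and f :: "real \<Rightarrow> real"
  assumes "\<alpha> > 0" and "n \<ge> 2" and "f \<in> Q_class n {0..<\<alpha>}"
  shows "(matrix_monotone (n - 1) {0<..<\<alpha>} (\<lambda>t. (f t - f 0) / t)
            \<longrightarrow> matrix_convex (n - 1) {0..<\<alpha>} f) \<and>
         (f 0 = 0 \<longrightarrow> matrix_monotone (n - 1) {0<..<\<alpha>} (\<lambda>t. f t / t)
            \<longrightarrow> matrix_convex (n - 1) {0..<\<alpha>} f)"
  using matrix_convex_of_monotone_quotient[OF assms(2,3)] by auto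

end
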